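(* Let $(S_1,S_2,P)$ be a $\Gamma_3$-contraction on a Hilbert space $\mathcal H$. Then there are unique operators $F_1,F_2\in\mathcal B(\mathcal D_P)$ such that $S_1-S_2^*P=D_PF_1D_P$ and $S_2-S_1^*P=D_PF_2D_P$. Moreover, the numerical radius satisfies $\omega(F_1+F_2z)\le3$ for all $z\in\mathbb T$.
   Context: $\Gamma_3=\{(z_1+z_2+z_3,\,z_1z_2+z_2z_3+z_3z_1,\,z_1z_2z_3):|z_i|\le1\}\subset\mathbb C^3$. A commuting triple is a $\Gamma_3$-contraction if its Taylor joint spectrum lies in $\Gamma_3$ and $\|f(S_1,S_2,P)\|\le\sup_{\Gamma_3}|f|$ for all rational $f$ with poles off $\Gamma_3$. $D_P=(I-P^*P)^{1/2}$, $\mathcal D_P=\overline{\operatorname{Ran}}D_P$. $\omega(A)=\sup\{|\langle Ax,x\rangle|:\|x\|=1\}$. *)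

theory Defs
  imports "HOL-Analysis.Analysis"
begin

text \<open>A complex Hilbert space is encoded as a real Hilbert space (type class
real_inner + complete_space) together with a complex structure J
(multiplication by the imaginary unit): J is real-linear, J o J = -id and J is
orthogonal.  The complex inner product is recovered from the real one.\<close>

definition complex_structure :: "('a::real_inner \<Rightarrow> 'a) \<Rightarrow> bool" where
  "complex_structure J \<longleftrightarrow> linear J \<and> (\<forall>x. J (J x) = - x) \<and> (\<forall>x y. inner (J x) (J y) = inner x y)"

definition cscale :: "('a::real_vector \<Rightarrow> 'a) \<Rightarrow> complex \<Rightarrow> 'a \<Rightarrow> 'a" where
  "cscale J c x = Re c *\<^sub>R x + Im c *\<^sub>R J x"

text \<open>complex inner product, linear in the first argument\<close>
definition cinner :: "('a::real_inner \<Rightarrow> 'a) \<Rightarrow> 'a \<Rightarrow> 'a \<Rightarrow> complex" where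
  "cinner J x y = Complex (inner x y) (inner x (J y))"

definition cblinear :: "('a::real_normed_vector \<Rightarrow> 'a) \<Rightarrow> ('a \<Rightarrow> 'a) \<Rightarrow> bool" where
  "cblinear J A \<longleftrightarrow> bounded_linear A \<and> (\<forall>x. A (J x) = J (A x))"

text \<open>Operators in B(V) for a closed subspace V, represented by bounded operators on H
leaving V invariant (only their restriction to V matters)\<close>
definition op_on :: "('a::real_normed_vector \<Rightarrow> 'a) \<Rightarrow> 'a set \<Rightarrow> ('a \<Rightarrow> 'a) \<Rightarrow> bool" where
  "op_on J V F \<longleftrightarrow> cblinear J F \<and> F ` V \<subseteq> V"

text \<open>The adjoint of a bounded complex-linear operator coincides with its real adjoint
(library constant adjoint).  Positive square root of a positive operator:\<close>
definition op_sqrt :: "('a::real_inner \<Rightarrow> 'a) \<Rightarrow> ('a \<Rightarrow> 'a) \<Rightarrow> ('a \<Rightarrow> 'a)" where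
  "op_sqrt J T = (THE D. cblinear J D \<and> (\<forall>x y. inner (D x) y = inner x (D y))
                       \<and> (\<forall>x. 0 \<le> inner (D x) x) \<and> D \<circ> D = T)"

definition defect_op :: "('a::real_inner \<Rightarrow> 'a) \<Rightarrow> ('a \<Rightarrow> 'a) \<Rightarrow> ('a \<Rightarrow> 'a)" where
  "defect_op J P = op_sqrt J (\<lambda>x. x - adjoint P (P x))"

definition defect_space :: "('a::real_inner \<Rightarrow> 'a) \<Rightarrow> ('a \<Rightarrow> 'a) \<Rightarrow> 'a set" where
  "defect_space J P = closure (range (defect_op J P))"

text \<open>numerical radius of an operator A on the subspace V (0 for the zero space)\<close>
definition numerical_radius :: "('a::real_inner \<Rightarrow> 'a) \<Rightarrow> 'a set \<Rightarrow> ('a \<Rightarrow> 'a) \<Rightarrow> real" where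
  "numerical_radius J V A = Sup (insert 0 {cmod (cinner J (A x) x) | x. x \<in> V \<and> norm x = 1})"

definition Gamma3 :: "(complex \<times> complex \<times> complex) set" where
  "Gamma3 = {(z1 + z2 + z3, z1 * z2 + z2 * z3 + z3 * z1, z1 * z2 * z3) | z1 z2 z3.
               cmod z1 \<le> 1 \<and> cmod z2 \<le> 1 \<and> cmod z3 \<le> 1}"

text \<open>Taylor joint spectrum of a commuting triple (A,B,C) via the Koszul complex
  0 -> H -d1-> H^3 -d2-> H^3 -d3-> H -> 0.\<close>
definition koszul_exact :: "('a \<Rightarrow> 'a) \<Rightarrow> ('a \<Rightarrow> 'a) \<Rightarrow> ('a \<Rightarrow> 'a) \<Rightarrow> ('a::real_vector \<Rightarrow> 'a) \<Rightarrow> bool" where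
  "koszul_exact J A B C \<longleftrightarrow>
     (\<forall>x. A x = 0 \<and> B x = 0 \<and> C x = 0 \<longrightarrow> x = 0)
   \<and> (\<forall>x y z. B x - A y = 0 \<and> C x - A z = 0 \<and> C y - B z = 0 \<longrightarrow>
        (\<exists>w. x = A w \<and> y = B w \<and> z = C w))
   \<and> (\<forall>u v w. C u - B v + A w = 0 \<longrightarrow>
        (\<exists>x y z. u = B x - A y \<and> v = C x - A z \<and> w = C y - B z))
   \<and> (\<forall>t. \<exists>u v w. t = C u - B v + A w)"

definition taylor_spectrum :: "('a::real_vector \<Rightarrow> 'a) \<Rightarrow> ('a \<Rightarrow> 'a) \<Rightarrow> ('a \<Rightarrow> 'a) \<Rightarrow> ('a \<Rightarrow> 'a)
     \<Rightarrow> (complex \<times> complex \<times> complex) set" where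
  "taylor_spectrum J A B C = {(l1, l2, l3). \<not> koszul_exact J
      (\<lambda>x. A x - cscale J l1 x) (\<lambda>x. B x - cscale J l2 x) (\<lambda>x. C x - cscale J l3 x)}"

definition poly3 :: "(nat \<Rightarrow> nat \<Rightarrow> nat \<Rightarrow> complex) \<Rightarrow> bool" where
  "poly3 c \<longleftrightarrow> finite {(i, j, k). c i j k \<noteq> 0}"

definition poly3_eval :: "(nat \<Rightarrow> nat \<Rightarrow> nat \<Rightarrow> complex) \<Rightarrow> complex \<times> complex \<times> complex \<Rightarrow> complex" where
  "poly3_eval c z = (\<Sum>(i, j, k)\<in>{(i, j, k). c i j k \<noteq> 0}.
       c i j k * fst z ^ i * fst (snd z) ^ j * snd (snd z) ^ k)"

definition poly3_op :: "('a::real_vector \<Rightarrow> 'a) \<Rightarrow> (nat \<Rightarrow> nat \<Rightarrow> nat \<Rightarrow> complex)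
     \<Rightarrow> ('a \<Rightarrow> 'a) \<Rightarrow> ('a \<Rightarrow> 'a) \<Rightarrow> ('a \<Rightarrow> 'a) \<Rightarrow> ('a \<Rightarrow> 'a)" where
  "poly3_op J c A B C = (\<lambda>x. \<Sum>(i, j, k)\<in>{(i, j, k). c i j k \<noteq> 0}.
       cscale J (c i j k) ((A ^^ i) ((B ^^ j) ((C ^^ k) x))))"

definition op_inverse :: "('a::real_normed_vector \<Rightarrow> 'a) \<Rightarrow> ('a \<Rightarrow> 'a) \<Rightarrow> ('a \<Rightarrow> 'a)" where
  "op_inverse J Q = (THE R. cblinear J R \<and> R \<circ> Q = id \<and> Q \<circ> R = id)"

definition rat3_op :: "('a::real_normed_vector \<Rightarrow> 'a) \<Rightarrow> (nat \<Rightarrow> nat \<Rightarrow> nat \<Rightarrow> complex)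
     \<Rightarrow> (nat \<Rightarrow> nat \<Rightarrow> nat \<Rightarrow> complex) \<Rightarrow> ('a \<Rightarrow> 'a) \<Rightarrow> ('a \<Rightarrow> 'a) \<Rightarrow> ('a \<Rightarrow> 'a) \<Rightarrow> ('a \<Rightarrow> 'a)" where
  "rat3_op J p q A B C = poly3_op J p A B C \<circ> op_inverse J (poly3_op J q A B C)"

definition gamma3_contraction :: "('a::real_inner \<Rightarrow> 'a) \<Rightarrow> ('a \<Rightarrow> 'a) \<Rightarrow> ('a \<Rightarrow> 'a) \<Rightarrow> ('a \<Rightarrow> 'a) \<Rightarrow> bool" where
  "gamma3_contraction J S1 S2 P \<longleftrightarrow>
     cblinear J S1 \<and> cblinear J S2 \<and> cblinear J P
   \<and> S1 \<circ> S2 = S2 \<circ> S1 \<and> S1 \<circ> P = P \<circ> S1 \<and> S2 \<circ> P = P \<circ> S2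
   \<and> taylor_spectrum J S1 S2 P \<subseteq> Gamma3
   \<and> (\<forall>p q. poly3 p \<and> poly3 q \<and> (\<forall>z\<in>Gamma3. poly3_eval q z \<noteq> 0) \<longrightarrow>
        onorm (rat3_op J p q S1 S2 P) \<le> (SUP z\<in>Gamma3. cmod (poly3_eval p z / poly3_eval q z)))"

end

theory Submission
  imports Defs
begin

text \<open>
On the tridisc \<open>\<bar>3p - s\<^sub>2\<bar> \<le> \<bar>3 - s\<^sub>1\<bar>\<close> and \<open>\<bar>3p - s\<^sub>1\<bar> \<le> \<bar>3 - s\<^sub>2\<bar>\<close>, because both quotients are unimodular on the
torus. After a rotation by a unimodular \<open>\<beta>\<close>, the spectral set property turns these into
\<open>\<parallel>(3\<beta>P - S\<^sub>2)x\<parallel> \<le> \<parallel>(3 - \<beta>S\<^sub>1)x\<parallel>\<close> and \<open>\<parallel>(3\<beta>P - S\<^sub>1)x\<parallel> \<le> \<parallel>(3 - \<beta>S\<^sub>2)x\<parallel>\<close>. Squaring gives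
\<open>6\<bar>\<langle>(S\<^sub>1 - S\<^sub>2\<^sup>*P)x, x\<rangle>\<bar> \<le> 9\<parallel>D\<^sub>P x\<parallel>\<^sup>2 + \<parallel>S\<^sub>1x\<parallel>\<^sup>2 - \<parallel>S\<^sub>2x\<parallel>\<^sup>2\<close> and its mirror image, and in the sum the last two
terms cancel:
\<open>\<bar>\<langle>(S\<^sub>1 - S\<^sub>2\<^sup>*P)x, x\<rangle>\<bar> + \<bar>\<langle>(S\<^sub>2 - S\<^sub>1\<^sup>*P)x, x\<rangle>\<bar> \<le> 3\<parallel>D\<^sub>P x\<parallel>\<^sup>2\<close>.
By polarization both sesquilinear forms are bounded with respect to \<open>\<parallel>D\<^sub>P x\<parallel> \<parallel>D\<^sub>P y\<parallel>\<close>, so they factor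
through \<open>D\<^sub>P\<close>, and the displayed inequality is the numerical radius bound.
\<close>

section \<open>Riesz representation and adjoints\<close>

text \<open>First-order condition at a minimum: for small \<open>t\<close> of sign opposite to
  \<open>b\<close> the linear term would dominate and make the expression negative.\<close>

lemma linear_coeff_zeroI:
  fixes b c :: real
  assumes "\<And>t. 0 \<le> 2 * t * b + t\<^sup>2 * c"
  shows "b = 0"
proof (rule ccontr)
  assume "b \<noteq> 0"
  define t where "t = - b / (\<bar>c\<bar> + 1)"
  have b: "b = - t * (\<bar>c\<bar> + 1)" unfolding t_def by (simp add: field_simps)
  have "t\<^sup>2 * (\<bar>c\<bar> + 2 + (\<bar>c\<bar> - c)) > 0"
    using \<open>b \<noteq> 0\<close> b by (intro mult_pos_pos) auto
  moreover have "2 * t * b + t\<^sup>2 * c = - (t\<^sup>2 * (\<bar>c\<bar> + 2 + (\<bar>c\<bar> - c)))"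
    unfolding b by (simp add: power2_eq_square algebra_simps)
  ultimately show False using assms[of t] by simp
qed

text \<open>Variational Riesz theorem relative to \<open>D\<close>: a minimizing sequence
  \<open>y n\<close> of \<open>\<phi>\<close> need not converge, but the images
  \<open>D (y n)\<close> do, and their limit represents \<open>g\<close>. With \<open>D = id\<close>
  this is the usual theorem; for the defect operator it yields vectors of the defect space.\<close>

lemma riesz_closure_range:
  fixes D :: "'b::real_vector \<Rightarrow> 'a::{real_inner, complete_space}" and g :: "'b \<Rightarrow> real"
  assumes D: "linear D" and g: "linear g" and K: "\<And>y. \<bar>g y\<bar> \<le> K * norm (D y)"
  shows "\<exists>u\<in>closure (range D). \<forall>y. g y = inner u (D y)"
proof -
  define \<phi> where "\<phi> y = (norm (D y))\<^sup>2 - 2 * g y" for y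
  have low: "- K\<^sup>2 \<le> \<phi> y" for y
  proof -
    have "0 \<le> (norm (D y) - K)\<^sup>2" by simp
    then show ?thesis using K[of y] unfolding \<phi>_def by (simp add: power2_eq_square algebra_simps)
  qed
  define m where "m = Inf (range \<phi>)"
  have bdd: "bdd_below (range \<phi>)" using low by (auto intro!: bdd_belowI2)
  have m_le: "m \<le> \<phi> y" for y unfolding m_def by (rule cInf_lower[OF _ bdd]) auto
  have "\<exists>y. \<phi> y < m + 1 / Suc n" for n
    using cInf_lessD[of "range \<phi>" "m + 1 / Suc n"] unfolding m_def by auto
  then obtain y where y: "\<And>n. \<phi> (y n) < m + 1 / Suc n" by metis
  \<comment> \<open>Parallelogram law: the midpoint of two near-minimizers still has
    \<open>\<phi>\<close>-value at least \<open>m\<close>.\<close>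
  have par: "(norm (D (y n) - D (y k)))\<^sup>2 \<le> 2 / Suc n + 2 / Suc k" for n k
  proof -
    have "(norm (D (y n) - D (y k)))\<^sup>2
      = 2 * \<phi> (y n) + 2 * \<phi> (y k) - 4 * \<phi> ((1/2) *\<^sub>R (y n + y k))"
      unfolding \<phi>_def
      by (simp add: linear_add[OF D] linear_add[OF g] linear_cmul[OF D] linear_cmul[OF g]
          power2_norm_eq_inner inner_add inner_diff inner_commute field_simps)
    then show ?thesis using y[of n] y[of k] m_le[of "(1/2) *\<^sub>R (y n + y k)"] by simp
  qed
  have "Cauchy (\<lambda>n. D (y n))"
  proof (rule metric_CauchyI)
    fix e :: real assume e: "e > 0"
    obtain N where N: "4 / e\<^sup>2 < real N" using reals_Archimedean2 by blast
    show "\<exists>M. \<forall>m\<ge>M. \<forall>n\<ge>M. dist (D (y m)) (D (y n)) < e"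
    proof (intro exI allI impI)
      fix i j assume "N \<le> i" "N \<le> j"
      have small: "2 / Suc i < e\<^sup>2 / 2" if "N \<le> i" for i
      proof -
        have "4 / e\<^sup>2 < real (Suc i)" using N that by linarith
        then show ?thesis using e by (simp add: field_simps)
      qed
      have "(norm (D (y i) - D (y j)))\<^sup>2 < e\<^sup>2"
        using par[of i j] small[OF \<open>N \<le> i\<close>] small[OF \<open>N \<le> j\<close>] by simp
      then show "dist (D (y i)) (D (y j)) < e"
        using e by (simp add: dist_norm power2_less_imp_less)
    qed
  qed
  then obtain u where u: "(\<lambda>n. D (y n)) \<longlonglongrightarrow> u"
    using Cauchy_convergent convergent_def by blast
  have u_in: "u \<in> closure (range D)"
    unfolding closure_sequential by (intro exI[of _ "\<lambda>n. D (y n)"] conjI allI rangeI u)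
  have "g x = inner u (D x)" for x
  proof -
    have "0 \<le> 2 * t * (inner u (D x) - g x) + t\<^sup>2 * (norm (D x))\<^sup>2" for t
    proof -
      \<comment> \<open>\<open>y n\<close> is a minimizer only up to \<open>1 / Suc n\<close>; the
        error disappears in the limit, leaving the first-order condition at
        \<open>u\<close>.\<close>
      have step: "- (1 / Suc n) \<le> 2 * t * (inner (D (y n)) (D x) - g x) + t\<^sup>2 * (norm (D x))\<^sup>2" for n
      proof -
        have "\<phi> (y n + t *\<^sub>R x) = \<phi> (y n) + 2 * t * (inner (D (y n)) (D x) - g x) + t\<^sup>2 * (norm (D x))\<^sup>2"
          unfolding \<phi>_def
          by (simp add: linear_add[OF D] linear_add[OF g] linear_cmul[OF D] linear_cmul[OF g]
              power2_norm_eq_inner inner_add inner_commute algebra_simps)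
            (simp add: power2_eq_square)
        then show ?thesis using y[of n] m_le[of "y n + t *\<^sub>R x"] by simp
      qed
      have lim: "(\<lambda>n. 2 * t * (inner (D (y n)) (D x) - g x) + t\<^sup>2 * (norm (D x))\<^sup>2)
          \<longlonglongrightarrow> 2 * t * (inner u (D x) - g x) + t\<^sup>2 * (norm (D x))\<^sup>2"
        by (intro tendsto_intros u)
      have lim0: "(\<lambda>n. - (1 / real (Suc n))) \<longlonglongrightarrow> 0"
        using tendsto_minus[OF LIMSEQ_inverse_real_of_nat] by (simp add: inverse_eq_divide)
      show ?thesis using LIMSEQ_le[OF lim0 lim] step by blast
    qed
    then show ?thesis using linear_coeff_zeroI by force
  qed
  then show ?thesis using u_in by blast
qed

text \<open>\<open>u - v\<close> is orthogonal to the range, hence to its closure, which contains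
  \<open>u\<close> and \<open>v\<close>; so it is orthogonal to itself.\<close>

lemma closure_range_eqI:
  fixes u v :: "'a::real_inner"
  assumes u: "u \<in> closure (range D)" and v: "v \<in> closure (range D)"
    and eq: "\<And>y. inner u (D y) = inner v (D y)"
  shows "u = v"
proof -
  have "closed {w. inner (u - v) w = 0}"
    by (intro closed_Collect_eq continuous_intros)
  then have "closure (range D) \<subseteq> {w. inner (u - v) w = 0}"
    by (intro closure_minimal) (auto simp: inner_diff_left eq)
  then have "inner (u - v) u = 0" "inner (u - v) v = 0" using u v by blast+
  then have "inner (u - v) (u - v) = 0" by (simp only: inner_diff_right)
  then show ?thesis by simp
qed

lemma riesz_representation:
  fixes g :: "'a::{real_inner, complete_space} \<Rightarrow> real"
  assumes "bounded_linear g"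
  shows "\<exists>u. \<forall>y. g y = inner u y"
proof -
  obtain K where "\<And>y. norm (g y) \<le> norm y * K"
    using bounded_linear.bounded[OF assms] by blast
  then have "\<bar>g y\<bar> \<le> K * norm (id y)" for y by (simp add: mult.commute)
  then show ?thesis
    using riesz_closure_range[of id g K] bounded_linear.linear[OF assms] linear_id
    by (auto simp: id_def)
qed

context
  fixes A :: "'a::{real_inner, complete_space} \<Rightarrow> 'a"
  assumes A: "bounded_linear A"
begin

text \<open>The constant \<open>adjoint\<close> is a choice, so its defining identity requires some
  adjoint to exist; Riesz representation supplies one pointwise.\<close>

lemma inner_adjoint_right: "inner x (adjoint A y) = inner (A x) y"
proof -
  have "\<exists>u. \<forall>x. inner (A x) y = inner x u" for y
  proof -
    have "bounded_linear (\<lambda>x. inner (A x) y)"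
      by (rule bounded_linear_compose[OF bounded_linear_inner_left A])
    from riesz_representation[OF this] show ?thesis by (auto simp: inner_commute)
  qed
  then have "\<exists>f. \<forall>x y. inner (A x) y = inner x (f y)" by metis
  then have "\<forall>x y. inner (A x) y = inner x (adjoint A y)"
    unfolding adjoint_def by (rule someI_ex)
  then show ?thesis by simp
qed

lemma inner_adjoint_left: "inner (adjoint A y) x = inner y (A x)"
  using inner_adjoint_right[of x y] by (simp add: inner_commute)

lemma bounded_linear_adjoint: "bounded_linear (adjoint A)"
proof -
  obtain K where K: "\<And>y. norm (A y) \<le> norm y * K" "K > 0"
    using bounded_linear.pos_bounded[OF A] by blast
  show ?thesis
  proof (rule bounded_linear_intro[where K = K])
    show "adjoint A (x + y) = adjoint A x + adjoint A y" for x y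
      by (rule vector_eq_rdot[THEN iffD1]) (simp add: inner_adjoint_left inner_add_left)
    show "adjoint A (r *\<^sub>R x) = r *\<^sub>R adjoint A x" for r x
      by (rule vector_eq_rdot[THEN iffD1]) (simp add: inner_adjoint_left)
    fix x
    have "(norm (adjoint A x))\<^sup>2 = inner x (A (adjoint A x))"
      by (simp add: power2_norm_eq_inner inner_adjoint_left)
    also have "\<dots> \<le> norm x * norm (A (adjoint A x))" by (rule norm_cauchy_schwarz)
    also have "\<dots> \<le> norm x * (norm (adjoint A x) * K)" by (intro mult_left_mono K) simp
    finally show "norm (adjoint A x) \<le> norm x * K"
      using K(2) by (cases "adjoint A x = 0") (simp_all add: power2_eq_square mult.assoc[symmetric] mult.commute)
  qed
qed

end

section \<open>Complex structures and complex-linear adjoints\<close>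

lemma complex_structure_inner:
  assumes "complex_structure J"
  shows "inner (J x) y = - inner x (J y)"
proof -
  have "inner (J (J x)) (J y) = inner (J x) y" using assms unfolding complex_structure_def by blast
  then have "inner (J x) y = inner (J (J x)) (J y)" by simp
  also have "\<dots> = - inner x (J y)" using assms by (simp add: complex_structure_def)
  finally show ?thesis .
qed

lemma complex_structure_norm:
  assumes "complex_structure J"
  shows "norm (J x) = norm x"
  using assms by (simp add: complex_structure_def norm_eq_sqrt_inner)

lemma complex_structure_bounded_linear:
  assumes "complex_structure J"
  shows "bounded_linear J"
  using assms complex_structure_norm[OF assms]
  by (intro bounded_linear_intro[where K = 1])
    (auto simp: complex_structure_def linear_add linear_cmul)

lemma cblinear_adjoint:
  fixes A :: "'a::{real_inner, complete_space} \<Rightarrow> 'a"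
  assumes J: "complex_structure J" and A: "cblinear J A"
  shows "cblinear J (adjoint A)"
proof -
  have bl: "bounded_linear A" and comm: "\<And>x. A (J x) = J (A x)"
    using A by (auto simp: cblinear_def)
  have "adjoint A (J y) = J (adjoint A y)" for y
    by (rule vector_eq_rdot[THEN iffD1])
      (simp add: inner_adjoint_left[OF bl] complex_structure_inner[OF J] comm)
  then show ?thesis using bounded_linear_adjoint[OF bl] by (simp add: cblinear_def)
qed

section \<open>The defect operator of a contraction\<close>

text \<open>Binomial square root without power series: the iterates of \<open>X \<mapsto> (t + X\<^sup>2) / 2\<close> are majorised,
  together with their increments, by the scalar iterates for \<open>t = 1\<close>, which increase to 1.
  The limit \<open>L\<close> satisfies \<open>(1 - L)\<^sup>2 = 1 - t\<close>.\<close>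

lemma sqrt_iteration:
  fixes t :: "'a::{real_normed_vector, complete_space} \<Rightarrow> 'a"
  assumes t: "bounded_linear t" and t1: "\<And>x. norm (t x) \<le> norm x"
  shows "\<exists>X L. (\<forall>x. X 0 x = 0) \<and> (\<forall>n x. X (Suc n) x = (1/2) *\<^sub>R (t x + X n (X n x)))
    \<and> (\<forall>x. (\<lambda>n::nat. X n x) \<longlonglongrightarrow> L x)
    \<and> bounded_linear L \<and> (\<forall>x. norm (L x) \<le> norm x) \<and> (\<forall>x. 2 *\<^sub>R L x = t x + L (L x))"
proof -
  define X :: "nat \<Rightarrow> 'a \<Rightarrow> 'a" where "X = rec_nat (\<lambda>_. 0) (\<lambda>_ Y x. (1/2) *\<^sub>R (t x + Y (Y x)))"
  define y :: "nat \<Rightarrow> real" where "y = rec_nat 0 (\<lambda>_ r. (1 + r\<^sup>2) / 2)"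
  have X0: "X 0 x = 0" and XS: "X (Suc n) x = (1/2) *\<^sub>R (t x + X n (X n x))" for n x
    by (simp_all add: X_def)
  have y0: "y 0 = 0" and yS: "y (Suc n) = (1 + (y n)\<^sup>2) / 2" for n
    by (simp_all add: y_def)
  have y01: "0 \<le> y n \<and> y n \<le> 1" for n
    by (induction n) (auto simp: y0 yS power_le_one)
  have y_step: "y n \<le> y (Suc n)" for n
  proof -
    have "0 \<le> (1 - y n)\<^sup>2" by simp
    then show ?thesis by (simp add: yS power2_eq_square algebra_simps)
  qed
  note tl = bounded_linear.linear[OF t]
  have Xadd: "X n (x + z) = X n x + X n z" for n x z
    by (induction n arbitrary: x z) (simp_all add: X0 XS linear_add[OF tl] scaleR_right_distrib)
  have Xscale: "X n (r *\<^sub>R x) = r *\<^sub>R X n x" for n r x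
    by (induction n arbitrary: x) (simp_all add: X0 XS linear_cmul[OF tl] scaleR_right_distrib)
  have Xdiff: "X n (x - z) = X n x - X n z" for n x z
    using Xadd[of n "x - z" z] by simp
  have nX: "norm (X n x) \<le> y n * norm x" for n x
  proof (induction n arbitrary: x)
    case (Suc n)
    have "norm (X n (X n x)) \<le> y n * (y n * norm x)"
      using Suc[of "X n x"] mult_left_mono[OF Suc[of x], of "y n"] y01[of n] by linarith
    then have "norm (t x + X n (X n x)) \<le> norm x + y n * (y n * norm x)"
      using t1[of x] norm_triangle_ineq[of "t x" "X n (X n x)"] by linarith
    then show ?case unfolding XS norm_scaleR yS by (simp add: power2_eq_square algebra_simps)
  qed (simp add: X0 y0)
  have nX1: "norm (X n x) \<le> norm x" for n x
    using nX[of n x] mult_right_mono[of "y n" 1 "norm x"] y01[of n] by simp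
  have nD: "norm (X (Suc n) x - X n x) \<le> (y (Suc n) - y n) * norm x" for n x
  proof (induction n arbitrary: x)
    case 0
    show ?case using t1[of x] by (simp add: X0 XS y0 yS)
  next
    case (Suc n)
    define d where "d = y (Suc n) - y n"
    have d: "0 \<le> d" using y_step[of n] by (simp add: d_def)
    have "X (Suc (Suc n)) x - X (Suc n) x = (1/2) *\<^sub>R (X (Suc n) (X (Suc n) x) - X n (X n x))"
      using XS[of "Suc n" x] XS[of n x] by (metis scaleR_diff_right add_diff_cancel_left)
    \<comment> \<open>A difference of squares: \<open>X (Suc n)\<close> applied to the increment,
      plus the increment applied to \<open>X n x\<close>. The squares of the scalar majorant
      \<open>y\<close> split in the same way.\<close>
    then have eq: "X (Suc (Suc n)) x - X (Suc n) x
        = (1/2) *\<^sub>R (X (Suc n) (X (Suc n) x - X n x) + (X (Suc n) (X n x) - X n (X n x)))"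
      by (simp only: Xdiff) simp
    have "norm (X (Suc n) (X (Suc n) x - X n x)) \<le> y (Suc n) * (d * norm x)"
      using nX[of "Suc n" "X (Suc n) x - X n x"] mult_left_mono[OF Suc[of x], of "y (Suc n)"] y01[of "Suc n"]
      unfolding d_def by linarith
    moreover have "norm (X (Suc n) (X n x) - X n (X n x)) \<le> d * (y n * norm x)"
      using Suc[of "X n x"] mult_left_mono[OF nX[of n x] d] unfolding d_def by linarith
    ultimately have "norm (X (Suc n) (X (Suc n) x - X n x) + (X (Suc n) (X n x) - X n (X n x)))
        \<le> y (Suc n) * (d * norm x) + d * (y n * norm x)"
      by (rule norm_triangle_mono)
    also have "\<dots> = ((y (Suc n))\<^sup>2 - (y n)\<^sup>2) * norm x"
      unfolding d_def by (simp add: power2_eq_square algebra_simps)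
    also have "\<dots> = 2 * ((y (Suc (Suc n)) - y (Suc n)) * norm x)"
      unfolding yS by (simp add: field_simps)
    finally show ?case unfolding eq norm_scaleR by simp
  qed
  have nD': "norm (X (n + k) x - X n x) \<le> (y (n + k) - y n) * norm x" for n k x
  proof (induction k)
    case (Suc k)
    have "norm (X (n + Suc k) x - X n x) \<le> norm (X (Suc (n + k)) x - X (n + k) x) + norm (X (n + k) x - X n x)"
      using norm_triangle_ineq[of "X (Suc (n + k)) x - X (n + k) x" "X (n + k) x - X n x"] by simp
    then show ?case using nD[of "n + k" x] Suc by (simp add: algebra_simps)
  qed simp
  have "convergent y"
    using y01 y_step by (intro Bseq_mono_convergent BseqI'[where K = 1]) (auto intro: lift_Suc_mono_le)
  then have yC: "Cauchy y" by (rule convergent_Cauchy)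
  have "convergent (\<lambda>n. X n x)" for x
  proof (intro Cauchy_convergent metric_CauchyI)
    fix e :: real assume "e > 0"
    define \<delta> where "\<delta> = e / (2 * (norm x + 1))"
    have x1: "0 < norm x + 1" by (simp add: add_nonneg_pos)
    then have "0 < \<delta>" using \<open>e > 0\<close> by (simp add: \<delta>_def)
    from metric_CauchyD[OF yC this] obtain N where N: "\<And>i. N \<le> i \<Longrightarrow> \<bar>y i - y N\<bar> < \<delta>"
      unfolding dist_real_def by blast
    have close: "norm (X i x - X N x) < e / 2" if "N \<le> i" for i
    proof -
      have "norm (X i x - X N x) \<le> (y i - y N) * norm x" using nD'[of N "i - N" x] that by simp
      also have "\<dots> \<le> \<bar>y i - y N\<bar> * (norm x + 1)" by (intro mult_mono) auto
      also have "\<dots> < \<delta> * (norm x + 1)"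
        using N[OF that] x1 by (intro mult_strict_right_mono) auto
      also have "\<dots> = e / 2" using x1 by (simp add: \<delta>_def field_simps)
      finally show ?thesis .
    qed
    have "dist (X i x) (X j x) < e" if "N \<le> i" "N \<le> j" for i j
      using close[OF that(1)] close[OF that(2)] dist_triangle_half_l[of "X i x" "X N x" e "X j x"]
      by (simp add: dist_norm norm_minus_commute)
    then show "\<exists>M. \<forall>m\<ge>M. \<forall>n\<ge>M. dist (X m x) (X n x) < e" by blast
  qed
  then have "\<exists>L. \<forall>x. (\<lambda>n. X n x) \<longlonglongrightarrow> L x" unfolding convergent_def by metis
  then obtain L where L: "\<And>x. (\<lambda>n. X n x) \<longlonglongrightarrow> L x" by blast
  have L1: "norm (L x) \<le> norm x" for x
    using nX1 by (intro LIMSEQ_le_const2[OF tendsto_norm[OF L]]) auto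
  have "bounded_linear L"
  proof (rule bounded_linear_intro[where K = 1])
    show "L (x + z) = L x + L z" for x z
      using LIMSEQ_unique[OF L[of "x + z"]] tendsto_add[OF L[of x] L[of z]] by (simp add: Xadd)
    show "L (r *\<^sub>R x) = r *\<^sub>R L x" for r x
      using LIMSEQ_unique[OF L[of "r *\<^sub>R x"]] tendsto_scaleR[OF tendsto_const L[of x]] by (simp add: Xscale)
  qed (use L1 in simp)
  moreover have "2 *\<^sub>R L x = t x + L (L x)" for x
  proof -
    \<comment> \<open>Convergence is only pointwise, so the outer \<open>X n\<close> is controlled
      by the uniform bound \<open>nX1\<close> while its argument converges.\<close>
    have "(\<lambda>n. norm (X n x - L x)) \<longlonglongrightarrow> 0"
      using L[of x] by (simp add: LIM_zero tendsto_norm_zero)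
    then have "(\<lambda>n. X n (X n x - L x)) \<longlonglongrightarrow> 0"
      by (rule Lim_null_comparison[rotated]) (simp add: nX1)
    from tendsto_add[OF this L[of "L x"]] have "(\<lambda>n. X n (X n x)) \<longlonglongrightarrow> L (L x)"
      by (simp add: Xdiff)
    then have "(\<lambda>n. 2 *\<^sub>R X (Suc n) x) \<longlonglongrightarrow> t x + L (L x)"
      by (simp add: XS tendsto_add)
    moreover have "(\<lambda>n. 2 *\<^sub>R X (Suc n) x) \<longlonglongrightarrow> 2 *\<^sub>R L x"
      by (intro tendsto_intros LIMSEQ_Suc[OF L])
    ultimately show ?thesis using LIMSEQ_unique by blast
  qed
  ultimately show ?thesis using X0 XS L L1 by blast
qed

section \<open>Positive operators and uniqueness of square roots\<close>

definition positive_op :: "('a::real_inner \<Rightarrow> 'a) \<Rightarrow> ('a \<Rightarrow> 'a) \<Rightarrow> bool" where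
  "positive_op J D \<longleftrightarrow> cblinear J D \<and> (\<forall>x y. inner (D x) y = inner x (D y)) \<and> (\<forall>x. 0 \<le> inner (D x) x)"

text \<open>The quadratic form attains its minimum 0 at \<open>x\<close>, so its first variation, a
  multiple of \<open>inner (D x) z\<close>, vanishes in every direction \<open>z\<close>.\<close>

lemma positive_op_kernel:
  assumes D: "positive_op J D" and "inner (D x) x = 0"
  shows "D x = 0"
proof -
  have lin: "linear D" and sym: "\<And>x y. inner (D x) y = inner x (D y)" and pos: "\<And>x. 0 \<le> inner (D x) x"
    using D by (auto simp: positive_op_def cblinear_def bounded_linear.linear)
  have "inner (D x) z = 0" for z
  proof (rule linear_coeff_zeroI)
    fix t :: real
    have "inner (D (x + t *\<^sub>R z)) (x + t *\<^sub>R z) = 2 * t * inner (D x) z + t\<^sup>2 * inner (D z) z"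
      using assms(2) sym[of x z]
      by (simp add: linear_add[OF lin] linear_cmul[OF lin] inner_add inner_commute power2_eq_square)
    then show "0 \<le> 2 * t * inner (D x) z + t\<^sup>2 * inner (D z) z"
      using pos[of "x + t *\<^sub>R z"] by simp
  qed
  then show ?thesis by (metis inner_eq_zero_iff)
qed

text \<open>For \<open>v = D x - E x\<close>, commutation gives
  \<open>D v + E v = D (D x) - E (E x) = 0\<close>. Two nonnegative forms with sum zero both vanish
  at \<open>v\<close>, so \<open>D v = E v = 0\<close>, and by symmetry
  \<open>inner v v = inner x (D v - E v) = 0\<close>.\<close>

lemma positive_op_sqrt_unique:
  assumes D: "positive_op J D" and E: "positive_op J E"
    and comm: "D \<circ> E = E \<circ> D" and sq: "D \<circ> D = E \<circ> E"
  shows "D = E"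
proof
  fix x
  have Dl: "linear D" and Ds: "\<And>x y. inner (D x) y = inner x (D y)" and Dp: "\<And>x. 0 \<le> inner (D x) x"
    using D by (auto simp: positive_op_def cblinear_def bounded_linear.linear)
  have El: "linear E" and Es: "\<And>x y. inner (E x) y = inner x (E y)" and Ep: "\<And>x. 0 \<le> inner (E x) x"
    using E by (auto simp: positive_op_def cblinear_def bounded_linear.linear)
  define v where "v = D x - E x"
  have "D v + E v = 0"
    using fun_cong[OF comm, of x] fun_cong[OF sq, of x]
    by (simp add: v_def linear_diff[OF Dl] linear_diff[OF El])
  then have "inner (D v) v + inner (E v) v = 0" by (metis inner_add_left inner_zero_left)
  then have "inner (D v) v = 0" "inner (E v) v = 0" using Dp[of v] Ep[of v] by linarith+
  then have "D v = 0" "E v = 0" using positive_op_kernel D E by blast+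
  moreover have "inner v v = inner x (D v) - inner x (E v)"
    by (subst (1) v_def) (simp add: inner_diff_left Ds Es)
  ultimately show "D x = E x" by (simp add: v_def)
qed

lemma adjoint_comp_self_contraction:
  fixes P :: "'a::{real_inner, complete_space} \<Rightarrow> 'a"
  assumes P: "bounded_linear P" and contr: "\<And>x. norm (P x) \<le> norm x"
  shows "norm (adjoint P (P x)) \<le> norm x"
proof -
  have "(norm (adjoint P (P x)))\<^sup>2 = inner (P x) (P (adjoint P (P x)))"
    by (simp add: power2_norm_eq_inner inner_adjoint_left[OF P])
  also have "\<dots> \<le> norm (P x) * norm (P (adjoint P (P x)))" by (rule norm_cauchy_schwarz)
  also have "\<dots> \<le> norm x * norm (adjoint P (P x))" by (intro mult_mono contr) auto
  finally show ?thesis by (cases "adjoint P (P x) = 0") (auto simp: power2_eq_square)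
qed

text \<open>\<open>op_sqrt\<close> is a definite description, so existence and uniqueness are both
  due. The root is \<open>1 - L\<close> for the limit \<open>L\<close> of
  \<open>sqrt_iteration\<close>; any other root commutes with it, so the two agree.\<close>

lemma defect_op_contraction:
  fixes P :: "'a::{real_inner, complete_space} \<Rightarrow> 'a"
  assumes J: "complex_structure J" and P: "cblinear J P" and contr: "\<And>x. norm (P x) \<le> norm x"
  shows "cblinear J (defect_op J P)"
    and "inner (defect_op J P x) y = inner x (defect_op J P y)"
    and "defect_op J P (defect_op J P x) = x - adjoint P (P x)"
proof -
  have bP: "bounded_linear P" and PJ: "\<And>x. P (J x) = J (P x)" using P by (auto simp: cblinear_def)
  have Jb: "bounded_linear J" by (rule complex_structure_bounded_linear[OF J])
  have "cblinear J (adjoint P)" by (rule cblinear_adjoint[OF J P])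
  then have bA: "bounded_linear (adjoint P)" and AJ: "\<And>x. adjoint P (J x) = J (adjoint P x)"
    by (auto simp: cblinear_def)
  define t where "t x = adjoint P (P x)" for x
  have bt: "bounded_linear t" unfolding t_def by (rule bounded_linear_compose[OF bA bP])
  have t1: "norm (t x) \<le> norm x" for x
    by (simp add: t_def adjoint_comp_self_contraction[OF bP contr])
  obtain X L where X0: "\<And>x. X 0 x = 0" and XS: "\<And>n x. X (Suc n) x = (1/2) *\<^sub>R (t x + X n (X n x))"
    and limx: "\<And>x. (\<lambda>n. X n x) \<longlonglongrightarrow> L x" and bL: "bounded_linear L"
    and L1: "\<And>x. norm (L x) \<le> norm x" and L: "\<And>x. 2 *\<^sub>R L x = t x + L (L x)"
    using sqrt_iteration[OF bt t1] by blast
  \<comment> \<open>Every iterate is a polynomial in \<open>t\<close>, so it commutes with each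
    bounded operator that commutes with \<open>t\<close>, and the limit inherits this.\<close>
  have commute: "L (B x) = B (L x)" if B: "bounded_linear B" and BT: "\<And>x. t (B x) = B (t x)" for B x
  proof -
    have "X n (B x) = B (X n x)" for n x
      by (induction n arbitrary: x)
        (simp_all add: X0 XS BT linear_add[OF bounded_linear.linear[OF B]]
          linear_cmul[OF bounded_linear.linear[OF B]] linear_0[OF bounded_linear.linear[OF B]])
    then have "(\<lambda>n. X n (B x)) \<longlonglongrightarrow> B (L x)"
      using bounded_linear.tendsto[OF B limx] by simp
    then show ?thesis using LIMSEQ_unique limx by blast
  qed
  have t_sym: "inner (t x) y = inner x (t y)" for x y
    by (simp add: t_def inner_adjoint_left[OF bP] inner_adjoint_right[OF bP])
  have "inner (X n x) y = inner x (X n y)" for n x y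
    by (induction n arbitrary: x y)
      (simp_all add: X0 XS t_sym inner_add_left inner_add_right)
  then have L_sym: "inner (L x) y = inner x (L y)" for x y
    using LIMSEQ_unique[OF tendsto_inner[OF limx[of x] tendsto_const[of y]]]
      tendsto_inner[OF tendsto_const[of x] limx[of y]] by simp
  define D where "D x = x - L x" for x
  have bD: "bounded_linear D" unfolding D_def
    by (intro bounded_linear_sub bounded_linear_ident bL)
  have "t (J x) = J (t x)" for x by (simp add: t_def PJ AJ)
  then have "D (J x) = J (D x)" for x
    using commute[OF Jb] by (simp add: D_def linear_diff[OF bounded_linear.linear[OF Jb]])
  moreover have "0 \<le> inner (D x) x" for x
  proof -
    have "inner (L x) x \<le> norm (L x) * norm x" by (rule norm_cauchy_schwarz)
    also have "\<dots> \<le> norm x * norm x"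
      by (intro mult_right_mono L1) auto
    finally show ?thesis by (simp add: D_def inner_diff_left power2_norm_eq_inner[symmetric] power2_eq_square)
  qed
  ultimately have posD: "positive_op J D"
    using bD L_sym by (auto simp: positive_op_def cblinear_def D_def inner_diff)
  have DD: "D (D x) = x - t x" for x
  proof -
    show ?thesis
      using L[of x] by (simp add: D_def linear_diff[OF bounded_linear.linear[OF bL]] scaleR_2 algebra_simps)
  qed
  have "defect_op J P = D"
    unfolding defect_op_def op_sqrt_def
  proof (rule the_equality)
    show "cblinear J D \<and> (\<forall>x y. inner (D x) y = inner x (D y)) \<and> (\<forall>x. 0 \<le> inner (D x) x)
      \<and> D \<circ> D = (\<lambda>x. x - adjoint P (P x))"
      using posD DD by (auto simp: positive_op_def t_def)
  next
    fix E
    assume E: "cblinear J E \<and> (\<forall>x y. inner (E x) y = inner x (E y)) \<and> (\<forall>x. 0 \<le> inner (E x) x)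
      \<and> E \<circ> E = (\<lambda>x. x - adjoint P (P x))"
    then have posE: "positive_op J E" unfolding positive_op_def by blast
    have bE: "bounded_linear E" using E by (simp add: cblinear_def)
    note Ediff = linear_diff[OF bounded_linear.linear[OF bE]]
    have EE: "E (E x) = x - t x" for x using E by (auto simp: t_def fun_eq_iff)
    \<comment> \<open>\<open>E\<close> commutes with its square \<open>1 - t\<close>, hence with
      \<open>t\<close>, hence with \<open>L\<close> and with \<open>D\<close>.\<close>
    have "E (x - t x) = E x - t (E x)" for x using EE[of x] EE[of "E x"] by simp
    then have "t (E x) = E (t x)" for x by (simp add: Ediff)
    from commute[OF bE this] have "E \<circ> D = D \<circ> E" by (auto simp: D_def Ediff)
    moreover have "E \<circ> E = D \<circ> D" using EE DD by auto
    ultimately show "E = D" using positive_op_sqrt_unique[OF posE posD] by simp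
  qed
  then show "cblinear J (defect_op J P)"
    and "inner (defect_op J P x) y = inner x (defect_op J P y)"
    and "defect_op J P (defect_op J P x) = x - adjoint P (P x)"
    using posD DD by (auto simp: positive_op_def t_def)
qed

section \<open>Inequalities on the symmetrized tridisc\<close>

lemma cmod_affine_power2:
  "(cmod (a * w + b))\<^sup>2 = (cmod a)\<^sup>2 * (cmod w)\<^sup>2 + (cmod b)\<^sup>2 + 2 * Re (cnj b * a * w)"
  unfolding cmod_power2 by (simp add: power2_eq_square algebra_simps)

lemma ex_unimodular_rotation: "\<exists>w. cmod w = 1 \<and> Re (u * w) = cmod u"
proof (cases "u = 0")
  case False
  have "u * (cnj u / of_real (cmod u)) = of_real (cmod u)"
    using False complex_norm_square[of u] by (simp add: field_simps power2_eq_square)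
  then show ?thesis using False
    by (intro exI[of _ "cnj u / of_real (cmod u)"]) (simp add: norm_divide)
qed (auto intro: exI[of _ 1])

text \<open>Maximum principle for a Moebius map whose pole lies outside the open disc.\<close>

lemma affine_dominated_on_disc:
  fixes a b c d z :: complex
  assumes cd: "cmod d \<le> cmod c"
    and circ: "\<And>w. cmod w = 1 \<Longrightarrow> cmod (a * w + b) \<le> cmod (d * w + c)"
    and z: "cmod z \<le> 1"
  shows "cmod (a * z + b) \<le> cmod (d * z + c)"
proof -
  define \<kappa> where "\<kappa> = cnj c * d - cnj b * a"
  define M where "M = (cmod c)\<^sup>2 - (cmod b)\<^sup>2"
  define N where "N = (cmod d)\<^sup>2 - (cmod a)\<^sup>2"
  define r where "r = cmod z"
  have H: "(cmod (d * w + c))\<^sup>2 - (cmod (a * w + b))\<^sup>2 = M + (cmod w)\<^sup>2 * N + 2 * Re (\<kappa> * w)" for w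
    unfolding cmod_affine_power2 M_def N_def \<kappa>_def by (simp add: algebra_simps)
  \<comment> \<open>The worst point of the unit circle is the one that turns
    \<open>\<kappa> * w\<close> into \<open>- cmod \<kappa>\<close>.\<close>
  obtain w where w: "cmod w = 1" "Re (- \<kappa> * w) = cmod (- \<kappa>)" using ex_unimodular_rotation by blast
  have "(cmod (a * w + b))\<^sup>2 \<le> (cmod (d * w + c))\<^sup>2" by (intro power_mono circ w(1)) simp
  moreover have "Re (\<kappa> * w) = - cmod \<kappa>" using w(2) by simp
  ultimately have MN: "2 * cmod \<kappa> \<le> M + N" using H[of w] unfolding w(1) power_one mult_1 by linarith
  \<comment> \<open>Combined with \<open>MN\<close>, the two signs of the absolute value bound the
    difference and the sum of \<open>cmod b\<close> and \<open>cmod a\<close> by those of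
    \<open>cmod c\<close> and \<open>cmod d\<close>; together these yield
    \<open>N \<le> M\<close>.\<close>
  have k: "\<bar>cmod c * cmod d - cmod a * cmod b\<bar> \<le> cmod \<kappa>"
    using norm_triangle_ineq3[of "cnj c * d" "cnj b * a"] by (simp add: \<kappa>_def norm_mult mult.commute)
  have "(cmod b - cmod a)\<^sup>2 \<le> (cmod c - cmod d)\<^sup>2"
    using MN k unfolding M_def N_def by (simp add: power2_eq_square algebra_simps)
  then have 1: "cmod b - cmod a \<le> cmod c - cmod d" by (rule power2_le_imp_le) (use cd in auto)
  have "(cmod b + cmod a)\<^sup>2 \<le> (cmod c + cmod d)\<^sup>2"
    using MN k unfolding M_def N_def by (simp add: power2_eq_square algebra_simps)
  then have 2: "cmod b + cmod a \<le> cmod c + cmod d" by (rule power2_le_imp_le) (use cd in auto)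
  have "(cmod b - cmod a) * (cmod b + cmod a) \<le> (cmod c - cmod d) * (cmod c + cmod d)"
  proof (cases "cmod a \<le> cmod b")
    case True
    then show ?thesis using 1 2 cd by (intro mult_mono) auto
  next
    case False
    then have "(cmod b - cmod a) * (cmod b + cmod a) \<le> 0" by (intro mult_nonpos_nonneg) auto
    also have "0 \<le> (cmod c - cmod d) * (cmod c + cmod d)" using cd by simp
    finally show ?thesis .
  qed
  then have NM: "N \<le> M" unfolding M_def N_def by (simp add: power2_eq_square algebra_simps)
  have r: "0 \<le> r" "r \<le> 1" using z by (auto simp: r_def)
  have "r * N \<le> M"
  proof (cases "0 \<le> N")
    case True
    then show ?thesis using r NM mult_right_mono[of r 1 N] by simp
  next
    case False
    then have "r * N \<le> 0" using r by (intro mult_nonneg_nonpos) auto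
    also have "0 \<le> M" using MN False norm_ge_zero[of \<kappa>] by linarith
    finally show ?thesis .
  qed
  \<comment> \<open>Factored form of the smallest value of \<open>H\<close> on the circle of radius
    \<open>r\<close>, with \<open>2 * cmod \<kappa>\<close> replaced by the larger
    \<open>M + N\<close>.\<close>
  then have "0 \<le> (1 - r) * (M - r * N)" using r by simp
  also have "\<dots> = M + r\<^sup>2 * N - r * (M + N)" by (simp add: power2_eq_square algebra_simps)
  also have "\<dots> \<le> M + r\<^sup>2 * N - r * (2 * cmod \<kappa>)" using mult_left_mono[OF MN r(1)] by simp
  also have "\<dots> \<le> M + r\<^sup>2 * N + 2 * Re (\<kappa> * z)"
  proof -
    have "- Re (\<kappa> * z) \<le> r * cmod \<kappa>"
      using complex_Re_le_cmod[of "- (\<kappa> * z)"] by (simp add: norm_mult r_def mult.commute)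
    then show ?thesis by (simp del: times_complex.sel)
  qed
  also have "\<dots> = (cmod (d * z + c))\<^sup>2 - (cmod (a * z + b))\<^sup>2" by (simp add: H r_def)
  finally have "(cmod (a * z + b))\<^sup>2 \<le> (cmod (d * z + c))\<^sup>2" by simp
  then show ?thesis by (rule power2_le_imp_le) simp
qed

section \<open>Scalar inequalities on the closed tridisc\<close>

lemma unit_circle_mult_cnj: "cmod z = 1 \<Longrightarrow> z * cnj z = 1"
  using complex_norm_square[of z] by simp

text \<open>On the torus conjugation is inversion, so the expression on the left is
  \<open>z1 * z2 * z3\<close> times the conjugate of the one on the right. With two variables fixed
  both are affine in the third, and the maximum principle fills the tridisc one variable at a
  time.\<close>

lemma tridisc_ineq1:
  assumes "cmod z1 \<le> 1" "cmod z2 \<le> 1" "cmod z3 \<le> 1"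
  shows "cmod (3 * (z1 * z2 * z3) - (z1 * z2 + z2 * z3 + z3 * z1)) \<le> cmod (3 - (z1 + z2 + z3))"
proof -
  define good where "good u v w \<longleftrightarrow> cmod (3 * (u * v * w) - (u * v + v * w + w * u)) \<le> cmod (3 - (u + v + w))"
    for u v w :: complex
  have torus: "good u v w" if "cmod u = 1" "cmod v = 1" "cmod w = 1" for u v w
  proof -
    note uc = that[THEN unit_circle_mult_cnj]
    have "3 * (u * v * w) - (u * v + v * w + w * u) = (u * v * w) * cnj (3 - (u + v + w))"
      using uc by simp algebra
    then have "cmod (3 * (u * v * w) - (u * v + v * w + w * u)) = cmod (3 - (u + v + w))"
      by (simp only: norm_mult complex_mod_cnj that mult_1)
    then show ?thesis by (simp add: good_def)
  qed
  have step: "good u v w"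
    if circ: "\<And>u. cmod u = 1 \<Longrightarrow> good u v w" and d: "cmod u \<le> 1" "cmod v \<le> 1" "cmod w \<le> 1" for u v w
  proof -
    \<comment> \<open>As a function of \<open>u\<close> the right-hand side is
      \<open>- u + (3 - v - w)\<close>; this bound keeps its zero out of the open disc.\<close>
    have "cmod (3 - v - w) \<ge> 1"
      using norm_triangle_ineq2[of 3 v] norm_triangle_ineq2[of "3 - v" w] d by simp
    then have cd: "cmod (- 1) \<le> cmod (3 - v - w)" by simp
    have "cmod ((3 * v * w - v - w) * u + - v * w) \<le> cmod (- 1 * u + (3 - v - w))"
    proof (rule affine_dominated_on_disc[OF cd _ d(1)])
      show "cmod ((3 * v * w - v - w) * u + - v * w) \<le> cmod (- 1 * u + (3 - v - w))" if "cmod u = 1" for u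
        using circ[OF that] by (simp add: good_def algebra_simps)
    qed
    then show ?thesis by (simp add: good_def algebra_simps)
  qed
  have rot: "good u v w \<longleftrightarrow> good v w u" for u v w
    by (simp add: good_def ac_simps)
  \<comment> \<open>Each of the three stages moves one more variable from the circle into the disc;
    \<open>rot\<close> brings the next circle variable to the first slot.\<close>
  have "good z1 v w" if "cmod v = 1" "cmod w = 1" for v w
    using step[of v w z1] torus that assms by auto
  then have "good z2 w z1" if "cmod w = 1" for w
    using step[of w z1 z2] rot that assms by auto
  then have "good z3 z1 z2"
    using step[of z1 z2 z3] rot assms by auto
  then show ?thesis using rot by (auto simp: good_def)
qed

text \<open>The scheme of \<open>tridisc_ineq1\<close> with the first two symmetric functions
  interchanged: on the torus, the conjugate of the second times the product is the first.\<close>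

lemma tridisc_ineq2:
  assumes "cmod z1 \<le> 1" "cmod z2 \<le> 1" "cmod z3 \<le> 1"
  shows "cmod (3 * (z1 * z2 * z3) - (z1 + z2 + z3)) \<le> cmod (3 - (z1 * z2 + z2 * z3 + z3 * z1))"
proof -
  define good where "good u v w \<longleftrightarrow> cmod (3 * (u * v * w) - (u + v + w)) \<le> cmod (3 - (u * v + v * w + w * u))"
    for u v w :: complex
  have torus: "good u v w" if "cmod u = 1" "cmod v = 1" "cmod w = 1" for u v w
  proof -
    note uc = that[THEN unit_circle_mult_cnj]
    have "3 * (u * v * w) - (u + v + w) = (u * v * w) * cnj (3 - (u * v + v * w + w * u))"
      using uc by simp algebra
    then have "cmod (3 * (u * v * w) - (u + v + w)) = cmod (3 - (u * v + v * w + w * u))"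
      by (simp only: norm_mult complex_mod_cnj that mult_1)
    then show ?thesis by (simp add: good_def)
  qed
  have step: "good u v w"
    if circ: "\<And>u. cmod u = 1 \<Longrightarrow> good u v w" and d: "cmod u \<le> 1" "cmod v \<le> 1" "cmod w \<le> 1" for u v w
  proof -
    have "cmod (- (v + w)) \<le> 2" using norm_triangle_ineq[of v w] d unfolding norm_minus_cancel by linarith
    moreover have "2 \<le> cmod (3 - v * w)"
      using norm_triangle_ineq2[of 3 "v * w"] d mult_mono[of "cmod v" 1 "cmod w" 1] by (simp add: norm_mult)
    ultimately have cd: "cmod (- (v + w)) \<le> cmod (3 - v * w)" by linarith
    have "cmod ((3 * v * w - 1) * u + - (v + w)) \<le> cmod (- (v + w) * u + (3 - v * w))"
    proof (rule affine_dominated_on_disc[OF cd _ d(1)])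
      show "cmod ((3 * v * w - 1) * u + - (v + w)) \<le> cmod (- (v + w) * u + (3 - v * w))" if "cmod u = 1" for u
        using circ[OF that] by (simp add: good_def algebra_simps)
    qed
    then show ?thesis by (simp add: good_def algebra_simps)
  qed
  have rot: "good u v w \<longleftrightarrow> good v w u" for u v w
    by (simp add: good_def ac_simps)
  have "good z1 v w" if "cmod v = 1" "cmod w = 1" for v w
    using step[of v w z1] torus that assms by auto
  then have "good z2 w z1" if "cmod w = 1" for w
    using step[of w z1 z2] rot that assms by auto
  then have "good z3 z1 z2"
    using step[of z1 z2 z3] rot assms by auto
  then show ?thesis using rot by (auto simp: good_def)
qed

section \<open>Scalar inequalities on \<open>Gamma3\<close> with a disc parameter\<close>

lemma Gamma3_bounds:
  assumes "(s1, s2, p) \<in> Gamma3"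
  shows "cmod s1 \<le> 3" "cmod s2 \<le> 3" "cmod p \<le> 1"
proof -
  obtain z1 z2 z3 where s: "s1 = z1 + z2 + z3" "s2 = z1 * z2 + z2 * z3 + z3 * z1" "p = z1 * z2 * z3"
    and z: "cmod z1 \<le> 1" "cmod z2 \<le> 1" "cmod z3 \<le> 1"
    using assms unfolding Gamma3_def by auto
  have prod: "cmod (u * v) \<le> 1" if "cmod u \<le> 1" "cmod v \<le> 1" for u v
    using that mult_mono[of "cmod u" 1 "cmod v" 1] by (simp add: norm_mult)
  show "cmod s1 \<le> 3"
    using norm_triangle_ineq[of "z1 + z2" z3] norm_triangle_ineq[of z1 z2] z unfolding s by linarith
  show "cmod s2 \<le> 3"
    using norm_triangle_ineq[of "z1 * z2 + z2 * z3" "z3 * z1"] norm_triangle_ineq[of "z1 * z2" "z2 * z3"]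
      prod[of z1 z2] prod[of z2 z3] prod[of z3 z1] z unfolding s by linarith
  show "cmod p \<le> 1" unfolding s by (intro prod z)
qed

text \<open>For unimodular \<open>\<alpha>\<close>, rotating every \<open>zi\<close> by
  \<open>\<alpha>\<close> turns \<open>(s1, s2, p)\<close> into
  \<open>(\<alpha> s1, \<alpha>^2 s2, \<alpha>^3 p)\<close>, and a factor \<open>\<alpha>^2\<close>
  drops out in modulus. As \<open>cmod s1 \<le> 3\<close>, the maximum principle in
  \<open>\<alpha>\<close> fills the disc.\<close>

lemma Gamma3_ineq1:
  assumes G: "(s1, s2, p) \<in> Gamma3" and \<alpha>: "cmod \<alpha> \<le> 1"
  shows "cmod (3 * \<alpha> * p - s2) \<le> cmod (3 - \<alpha> * s1)"
proof -
  obtain z1 z2 z3 where s: "s1 = z1 + z2 + z3" "s2 = z1 * z2 + z2 * z3 + z3 * z1" "p = z1 * z2 * z3"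
    and z: "cmod z1 \<le> 1" "cmod z2 \<le> 1" "cmod z3 \<le> 1"
    using G unfolding Gamma3_def by auto
  have circ: "cmod (3 * p * w + - s2) \<le> cmod (- s1 * w + 3)" if w: "cmod w = 1" for w
  proof -
    have "cmod (3 * p * w + - s2) = cmod (w * w * (3 * p * w + - s2))" by (simp add: norm_mult w)
    also have "w * w * (3 * p * w + - s2)
        = 3 * ((w * z1) * (w * z2) * (w * z3)) - ((w * z1) * (w * z2) + (w * z2) * (w * z3) + (w * z3) * (w * z1))"
      unfolding s by (simp add: algebra_simps)
    also have "cmod \<dots> \<le> cmod (3 - (w * z1 + w * z2 + w * z3))"
      using z by (intro tridisc_ineq1) (simp_all add: norm_mult w)
    also have "3 - (w * z1 + w * z2 + w * z3) = - s1 * w + 3" unfolding s by (simp add: algebra_simps)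
    finally show ?thesis .
  qed
  have "cmod (3 * p * \<alpha> + - s2) \<le> cmod (- s1 * \<alpha> + 3)"
    by (rule affine_dominated_on_disc[OF _ circ \<alpha>]) (simp_all add: Gamma3_bounds[OF G])
  then show ?thesis by (simp add: algebra_simps)
qed

lemma Gamma3_ineq2:
  assumes G: "(s1, s2, p) \<in> Gamma3" and \<alpha>: "cmod \<alpha> \<le> 1"
  shows "cmod (3 * \<alpha> * p - s1) \<le> cmod (3 - \<alpha> * s2)"
proof -
  obtain z1 z2 z3 where s: "s1 = z1 + z2 + z3" "s2 = z1 * z2 + z2 * z3 + z3 * z1" "p = z1 * z2 * z3"
    and z: "cmod z1 \<le> 1" "cmod z2 \<le> 1" "cmod z3 \<le> 1"
    using G unfolding Gamma3_def by auto
  have circ: "cmod (3 * p * w + - s1) \<le> cmod (- s2 * w + 3)" if w: "cmod w = 1" for w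
  proof -
    \<comment> \<open>\<open>s2\<close> scales by the square of the rotation, so the points are
      rotated by a square root of \<open>w\<close>.\<close>
    define v where "v = csqrt w"
    have vw: "w = v * v" by (simp add: v_def flip: power2_eq_square)
    have v: "cmod v = 1" by (simp add: v_def w)
    have "cmod (3 * p * w + - s1) = cmod (v * (3 * p * w + - s1))" by (simp add: norm_mult v)
    also have "v * (3 * p * w + - s1)
        = 3 * ((v * z1) * (v * z2) * (v * z3)) - (v * z1 + v * z2 + v * z3)"
      unfolding s vw by (simp add: algebra_simps)
    also have "cmod \<dots> \<le> cmod (3 - ((v * z1) * (v * z2) + (v * z2) * (v * z3) + (v * z3) * (v * z1)))"
      using z by (intro tridisc_ineq2) (simp_all add: norm_mult v)
    also have "3 - ((v * z1) * (v * z2) + (v * z2) * (v * z3) + (v * z3) * (v * z1)) = - s2 * w + 3"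
      unfolding s vw by (simp add: algebra_simps)
    finally show ?thesis .
  qed
  have "cmod (3 * p * \<alpha> + - s1) \<le> cmod (- s2 * \<alpha> + 3)"
    by (rule affine_dominated_on_disc[OF _ circ \<alpha>]) (simp_all add: Gamma3_bounds[OF G])
  then show ?thesis by (simp add: algebra_simps)
qed

section \<open>Complex scalars\<close>

lemma cscale_0_left [simp]: "cscale J 0 x = 0"
  by (simp add: cscale_def)

lemma cscale_one [simp]: "cscale J 1 x = x"
  by (simp add: cscale_def)

lemma cscale_minus: "cscale J (- c) x = - cscale J c x"
  by (simp add: cscale_def)

lemma cblinear_cscale_compose:
  assumes J: "complex_structure J" and A: "cblinear J A"
  shows "cblinear J (\<lambda>x. cscale J c (A x))"
proof -
  have bJ: "bounded_linear J" by (rule complex_structure_bounded_linear[OF J])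
  have bA: "bounded_linear A" and AJ: "\<And>x. A (J x) = J (A x)" using A by (auto simp: cblinear_def)
  have "bounded_linear (\<lambda>x. cscale J c (A x))"
    unfolding cscale_def
    by (intro bounded_linear_add bounded_linear_scaleR_right[THEN bounded_linear_compose]
        bA bounded_linear_compose[OF bJ bA])
  then show ?thesis
    using bJ by (simp add: cblinear_def cscale_def AJ linear_simps)
qed

lemma cblinear_add: "cblinear J A \<Longrightarrow> cblinear J B \<Longrightarrow> complex_structure J \<Longrightarrow> cblinear J (\<lambda>x. A x + B x)"
  using complex_structure_bounded_linear[of J] by (auto simp: cblinear_def linear_simps intro: bounded_linear_add)

lemma cblinear_diff: "cblinear J A \<Longrightarrow> cblinear J B \<Longrightarrow> complex_structure J \<Longrightarrow> cblinear J (\<lambda>x. A x - B x)"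
  using complex_structure_bounded_linear[of J] by (auto simp: cblinear_def linear_simps intro: bounded_linear_sub)

lemma cblinear_compose: "cblinear J A \<Longrightarrow> cblinear J B \<Longrightarrow> cblinear J (\<lambda>x. A (B x))"
  by (auto simp: cblinear_def intro: bounded_linear_compose)

lemma cblinear_ident: "cblinear J (\<lambda>x. x)"
  by (simp add: cblinear_def bounded_linear_ident)

lemma cinner_cscale_left:
  assumes "complex_structure J"
  shows "cinner J (cscale J c x) y = c * cinner J x y"
  using assms unfolding cinner_def cscale_def complex_eq_iff
  by (simp add: inner_add_left complex_structure_inner[OF assms]) (simp add: complex_structure_def)

lemma cinner_add_left: "cinner J (x + y) z = cinner J x z + cinner J y z"
  by (simp add: cinner_def complex_eq_iff inner_add_left)

lemma cinner_diff_left: "cinner J (x - y) z = cinner J x z - cinner J y z"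
  by (simp add: cinner_def complex_eq_iff inner_diff_left)

text \<open>Pythagoras: \<open>x\<close> and \<open>J x\<close> are orthogonal and of equal
  length.\<close>

lemma norm_cscale:
  assumes J: "complex_structure J"
  shows "norm (cscale J c x) = cmod c * norm x"
proof -
  have "inner x (J x) = 0" using complex_structure_inner[OF J, of x x] by (simp add: inner_commute)
  moreover have "inner (J x) (J x) = inner x x" using J by (simp add: complex_structure_def)
  ultimately have "(norm (cscale J c x))\<^sup>2 = (cmod c * norm x)\<^sup>2"
    unfolding power_mult_distrib cmod_power2
    by (simp add: cscale_def power2_norm_eq_inner inner_add inner_commute)
      (simp add: power2_eq_square algebra_simps)
  then show ?thesis by (simp add: power2_eq_iff_nonneg)
qed

section \<open>The spectral set inequality\<close>

text \<open>Coefficients of the polynomial \<open>a + b s\<^sub>1 + c s\<^sub>2 + d p\<close>.\<close>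

definition affine3 :: "complex \<Rightarrow> complex \<Rightarrow> complex \<Rightarrow> complex \<Rightarrow> nat \<Rightarrow> nat \<Rightarrow> nat \<Rightarrow> complex" where
  "affine3 a b c d i j k = (if (i, j, k) = (0, 0, 0) then a else if (i, j, k) = (1, 0, 0) then b
     else if (i, j, k) = (0, 1, 0) then c else if (i, j, k) = (0, 0, 1) then d else 0)"

lemma affine3_support:
  "{(i, j, k). affine3 a b c d i j k \<noteq> 0} \<subseteq> {(0, 0, 0), (1, 0, 0), (0, 1, 0), (0, 0, 1)}"
  by (auto simp: affine3_def split: if_splits)

lemma poly3_affine3: "poly3 (affine3 a b c d)"
  unfolding poly3_def by (rule finite_subset[OF affine3_support]) simp

lemma poly3_eval_affine3:
  "poly3_eval (affine3 a b c d) (s1, s2, p) = a + b * s1 + c * s2 + d * p"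
proof -
  have "poly3_eval (affine3 a b c d) (s1, s2, p)
    = (\<Sum>(i, j, k)\<in>{(0, 0, 0), (1, 0, 0), (0, 1, 0), (0, 0, 1)}. affine3 a b c d i j k * s1 ^ i * s2 ^ j * p ^ k)"
    unfolding poly3_eval_def by (intro sum.mono_neutral_cong_left affine3_support) auto
  also have "\<dots> = a + b * s1 + c * s2 + d * p" by (simp add: affine3_def)
  finally show ?thesis .
qed

lemma poly3_op_affine3:
  "poly3_op J (affine3 a b c d) A B C x
    = cscale J a x + cscale J b (A x) + cscale J c (B x) + cscale J d (C x)"
proof -
  have "poly3_op J (affine3 a b c d) A B C x
    = (\<Sum>(i, j, k)\<in>{(0, 0, 0), (1, 0, 0), (0, 1, 0), (0, 0, 1)}.
        cscale J (affine3 a b c d i j k) ((A ^^ i) ((B ^^ j) ((C ^^ k) x))))"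
    unfolding poly3_op_def by (intro sum.mono_neutral_cong_left affine3_support) auto
  also have "\<dots> = cscale J a x + cscale J b (A x) + cscale J c (B x) + cscale J d (C x)"
    by (simp add: affine3_def)
  finally show ?thesis .
qed

lemma cblinear_poly3_op_affine3:
  assumes J: "complex_structure J" and "cblinear J A" "cblinear J B" "cblinear J C"
  shows "cblinear J (poly3_op J (affine3 a b c d) A B C)"
  unfolding poly3_op_affine3[abs_def]
  by (intro cblinear_add cblinear_cscale_compose cblinear_ident assms)

lemma op_inverse_eq:
  assumes "cblinear J R" "R \<circ> Q = id" "Q \<circ> R = id"
  shows "op_inverse J Q = R"
  unfolding op_inverse_def
proof (rule the_equality)
  fix R' assume R': "cblinear J R' \<and> R' \<circ> Q = id \<and> Q \<circ> R' = id"
  then have "R' \<circ> (Q \<circ> R) = R" by (simp add: comp_assoc[symmetric])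
  then show "R' = R" using assms by simp
qed (use assms in auto)

lemma Gamma3_nonempty: "Gamma3 \<noteq> {}"
proof -
  have "(0, 0, 0) \<in> Gamma3"
    unfolding Gamma3_def mem_Collect_eq by (intro exI[of _ 0]) simp
  then show ?thesis by blast
qed

text \<open>The spectral set bound for \<open>p / q\<close> is applied to the image of
  \<open>x\<close> under the denominator, which gives an inequality free of inverses. The inverse
  \<open>R\<close> is an argument, to be constructed for each concrete \<open>q\<close>.\<close>

lemma gamma3_contraction_norm_le:
  fixes S1 :: "'a::real_inner \<Rightarrow> 'a"
  assumes G: "gamma3_contraction J S1 S2 P" and pq: "poly3 p" "poly3 q"
    and q0: "\<And>z. z \<in> Gamma3 \<Longrightarrow> poly3_eval q z \<noteq> 0"
    and le: "\<And>z. z \<in> Gamma3 \<Longrightarrow> cmod (poly3_eval p z) \<le> M * cmod (poly3_eval q z)"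
    and bp: "bounded_linear (poly3_op J p S1 S2 P)"
    and R: "cblinear J R" "R \<circ> poly3_op J q S1 S2 P = id" "poly3_op J q S1 S2 P \<circ> R = id"
  shows "norm (poly3_op J p S1 S2 P x) \<le> M * norm (poly3_op J q S1 S2 P x)"
proof -
  let ?p = "poly3_op J p S1 S2 P" and ?q = "poly3_op J q S1 S2 P"
  have rat: "rat3_op J p q S1 S2 P = ?p \<circ> R"
    unfolding rat3_op_def by (simp add: op_inverse_eq[OF R])
  have "onorm (?p \<circ> R) \<le> (SUP z\<in>Gamma3. cmod (poly3_eval p z / poly3_eval q z))"
    using G pq q0 unfolding gamma3_contraction_def rat[symmetric] by blast
  also have "\<dots> \<le> M"
    using q0 le by (intro cSUP_least Gamma3_nonempty) (simp add: norm_divide divide_le_eq)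
  finally have on: "onorm (?p \<circ> R) \<le> M" .
  have bl: "bounded_linear (?p \<circ> R)"
    using bounded_linear_compose[OF bp, of R] R(1) unfolding cblinear_def comp_def by blast
  have "norm (?p x) = norm ((?p \<circ> R) (?q x))" using fun_cong[OF R(2), of x] by simp
  also have "\<dots> \<le> onorm (?p \<circ> R) * norm (?q x)" by (rule onorm[OF bl])
  also have "\<dots> \<le> M * norm (?q x)" by (rule mult_right_mono[OF on norm_ge_zero])
  finally show ?thesis .
qed

text \<open>The spectral set bound for the coordinate functions over the constant denominator 1,
  whose inverse is \<open>id\<close>.\<close>

lemma gamma3_contraction_coord_norm_le:
  fixes S1 :: "'a::real_inner \<Rightarrow> 'a"
  assumes J: "complex_structure J" and G: "gamma3_contraction J S1 S2 P"
  shows "norm (S1 x) \<le> 3 * norm x" "norm (S2 x) \<le> 3 * norm x" "norm (P x) \<le> norm x"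
proof -
  have cb: "cblinear J S1" "cblinear J S2" "cblinear J P"
    using G by (auto simp: gamma3_contraction_def)
  have bound: "norm (poly3_op J (affine3 0 b c d) S1 S2 P x) \<le> M * norm x"
    if "\<And>s1 s2 p. (s1, s2, p) \<in> Gamma3 \<Longrightarrow> cmod (b * s1 + c * s2 + d * p) \<le> M" for b c d M
  proof -
    have id: "poly3_op J (affine3 1 0 0 0) S1 S2 P = id" by (auto simp: poly3_op_affine3)
    have "norm (poly3_op J (affine3 0 b c d) S1 S2 P x) \<le> M * norm (poly3_op J (affine3 1 0 0 0) S1 S2 P x)"
      using cblinear_poly3_op_affine3[OF J cb] that
      by (intro gamma3_contraction_norm_le[OF G, where R = id] poly3_affine3)
        (auto simp: poly3_eval_affine3 id cblinear_def bounded_linear_ident id_def)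
    then show ?thesis by (simp add: id)
  qed
  show "norm (S1 x) \<le> 3 * norm x"
    using bound[of 1 0 0 3] Gamma3_bounds by (simp add: poly3_op_affine3)
  show "norm (S2 x) \<le> 3 * norm x"
    using bound[of 0 1 0 3] Gamma3_bounds by (simp add: poly3_op_affine3)
  show "norm (P x) \<le> norm x"
    using bound[of 0 0 1 1] Gamma3_bounds by (simp add: poly3_op_affine3)
qed

text \<open>Surjectivity of \<open>c - K\<close> comes from the Banach fixed point of
  \<open>x \<mapsto> (y + K x) / c\<close>, a contraction with factor \<open>k / c\<close>. The
  lower bound \<open>(c - k) * norm x\<close> gives injectivity, hence linearity of the inverse, and
  also its boundedness.\<close>

lemma cblinear_scale_minus_inverse:
  fixes K :: "'a::{real_inner, complete_space} \<Rightarrow> 'a"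
  assumes J: "complex_structure J" and K: "cblinear J K" and k: "\<And>x. norm (K x) \<le> k * norm x"
    and kc: "0 \<le> k" "k < c"
  obtains R where "cblinear J R" "\<And>x. R (c *\<^sub>R x - K x) = x" "\<And>y. c *\<^sub>R R y - K (R y) = y"
proof -
  have bK: "bounded_linear K" and KJ: "\<And>x. K (J x) = J (K x)" using K by (auto simp: cblinear_def)
  note Jl = complex_structure_bounded_linear[OF J]
  have c: "c > 0" using kc by simp
  define Q where "Q x = c *\<^sub>R x - K x" for x
  have low: "(c - k) * norm x \<le> norm (Q x)" for x
    using norm_triangle_ineq2[of "c *\<^sub>R x" "K x"] k[of x] c by (simp add: Q_def algebra_simps)
  have Qdiff: "Q (x - z) = Q x - Q z" for x z
    using bK by (simp add: Q_def linear_simps algebra_simps)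
  have inj: "x = z" if "Q x = Q z" for x z
  proof -
    have "(c - k) * norm (x - z) \<le> 0" using low[of "x - z"] that by (simp add: Qdiff)
    then show ?thesis using kc by (simp add: mult_le_0_iff)
  qed
  have "\<exists>x. Q x = y" for y
  proof -
    define f where "f x = (1 / c) *\<^sub>R (y + K x)" for x
    have "dist (f x) (f z) \<le> (k / c) * dist x z" for x z
    proof -
      have "f x - f z = (1 / c) *\<^sub>R K (x - z)" using bK by (simp add: f_def linear_simps algebra_simps)
      then show ?thesis using k[of "x - z"] c by (simp add: dist_norm field_simps)
    qed
    then obtain x where x: "f x = x"
      using banach_fix_type[of "k / c" f] kc by auto
    have "c *\<^sub>R f x = y + K x" using c by (simp add: f_def)
    then have "c *\<^sub>R x = y + K x" by (simp only: x)
    then show ?thesis by (auto simp: Q_def intro: exI[of _ x])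
  qed
  then obtain R where QR: "\<And>y. Q (R y) = y" by metis
  have RQ: "R (Q x) = x" for x by (rule inj) (rule QR)
  have "bounded_linear R"
  proof (rule bounded_linear_intro[where K = "1 / (c - k)"])
    show "R (x + y) = R x + R y" for x y
    proof (rule inj)
      have "Q (R x + R y) = Q (R x) + Q (R y)" using bK by (simp add: Q_def linear_simps algebra_simps)
      then show "Q (R (x + y)) = Q (R x + R y)" by (simp add: QR)
    qed
    show "R (r *\<^sub>R x) = r *\<^sub>R R x" for r x
    proof (rule inj)
      have "Q (r *\<^sub>R R x) = r *\<^sub>R Q (R x)" using bK by (simp add: Q_def linear_simps algebra_simps)
      then show "Q (R (r *\<^sub>R x)) = Q (r *\<^sub>R R x)" by (simp add: QR)
    qed
    show "norm (R y) \<le> norm y * (1 / (c - k))" for y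
      using low[of "R y"] kc by (simp add: QR field_simps)
  qed
  moreover have "R (J y) = J (R y)" for y
  proof (rule inj)
    have "Q (J (R y)) = J (Q (R y))" using Jl by (simp add: Q_def KJ linear_simps)
    then show "Q (R (J y)) = Q (J (R y))" by (simp add: QR)
  qed
  ultimately show ?thesis using that[of R] QR RQ by (simp add: cblinear_def Q_def)
qed

text \<open>Since \<open>cmod \<alpha> < 1\<close>, the operators \<open>\<alpha> S1\<close> and
  \<open>\<alpha> S2\<close> have norm below 3 and the denominators are invertible; for the same
  reason their scalar counterparts have no zero on \<open>Gamma3\<close>. So the scalar inequalities
  transfer to operators.\<close>

lemma pencil_open_disc:
  fixes S1 :: "'a::{real_inner, complete_space} \<Rightarrow> 'a"
  assumes J: "complex_structure J" and G: "gamma3_contraction J S1 S2 P" and \<alpha>: "cmod \<alpha> < 1"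
  shows "norm (3 *\<^sub>R cscale J \<alpha> (P x) - S2 x) \<le> norm (3 *\<^sub>R x - cscale J \<alpha> (S1 x))"
    and "norm (3 *\<^sub>R cscale J \<alpha> (P x) - S1 x) \<le> norm (3 *\<^sub>R x - cscale J \<alpha> (S2 x))"
proof -
  have cb: "cblinear J S1" "cblinear J S2" "cblinear J P"
    using G by (auto simp: gamma3_contraction_def)
  note coord = gamma3_contraction_coord_norm_le[OF J G]
  have main: "norm (poly3_op J p S1 S2 P x) \<le> norm (poly3_op J q S1 S2 P x)"
    if S: "cblinear J S" "\<And>x. norm (S x) \<le> 3 * norm x"
      and q: "\<And>x. poly3_op J q S1 S2 P x = 3 *\<^sub>R x - cscale J \<alpha> (S x)"
      and pq: "p = affine3 a b c d" "q = affine3 a' b' c' d'"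
      and q0: "\<And>z. z \<in> Gamma3 \<Longrightarrow> poly3_eval q z \<noteq> 0"
      and le: "\<And>z. z \<in> Gamma3 \<Longrightarrow> cmod (poly3_eval p z) \<le> cmod (poly3_eval q z)"
    for p q S a b c d a' b' c' d'
  proof -
    have "norm (cscale J \<alpha> (S x)) \<le> (cmod \<alpha> * 3) * norm x" for x
      using mult_left_mono[OF S(2)[of x] norm_ge_zero[of \<alpha>]] by (simp add: norm_cscale[OF J] mult.assoc)
    then obtain R where R: "cblinear J R" "\<And>x. R (3 *\<^sub>R x - cscale J \<alpha> (S x)) = x"
      "\<And>y. 3 *\<^sub>R R y - cscale J \<alpha> (S (R y)) = y"
      using cblinear_scale_minus_inverse[OF J cblinear_cscale_compose[OF J S(1)], of \<alpha> "cmod \<alpha> * 3" 3] \<alpha>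
      by auto
    have "norm (poly3_op J p S1 S2 P x) \<le> 1 * norm (poly3_op J q S1 S2 P x)"
    proof (rule gamma3_contraction_norm_le[OF G _ _ q0 _ _ R(1)])
      show "bounded_linear (poly3_op J p S1 S2 P)"
        using cblinear_poly3_op_affine3[OF J cb] by (simp add: pq(1) cblinear_def)
      show "poly3 p" "poly3 q" unfolding pq by (rule poly3_affine3)+
      show "R \<circ> poly3_op J q S1 S2 P = id" "poly3_op J q S1 S2 P \<circ> R = id"
        by (auto simp: q R)
    qed (use le in auto)
    then show ?thesis by simp
  qed
  have nz: "3 - \<alpha> * s \<noteq> 0" if "cmod s \<le> 3" for s
  proof
    assume "3 - \<alpha> * s = 0"
    then have "cmod (\<alpha> * s) = 3" by (metis norm_numeral eq_iff_diff_eq_0)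
    moreover have "cmod \<alpha> * cmod s \<le> cmod \<alpha> * 3" using that by (intro mult_left_mono) auto
    ultimately show False using \<alpha> by (simp add: norm_mult)
  qed
  have three: "cscale J 3 y = 3 *\<^sub>R y" "cscale J (3 * \<alpha>) y = 3 *\<^sub>R cscale J \<alpha> y" for y
    by (simp_all add: cscale_def algebra_simps)
  have "norm (poly3_op J (affine3 0 0 (- 1) (3 * \<alpha>)) S1 S2 P x)
      \<le> norm (poly3_op J (affine3 3 (- \<alpha>) 0 0) S1 S2 P x)"
  proof (rule main[OF cb(1) coord(1) _ refl refl])
    show "poly3_op J (affine3 3 (- \<alpha>) 0 0) S1 S2 P x = 3 *\<^sub>R x - cscale J \<alpha> (S1 x)" for x
      by (simp add: poly3_op_affine3 three cscale_minus)
    fix z :: "complex \<times> complex \<times> complex" assume z: "z \<in> Gamma3"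
    obtain s1 s2 p where zz: "z = (s1, s2, p)" by (metis prod_cases3)
    show "poly3_eval (affine3 3 (- \<alpha>) 0 0) z \<noteq> 0"
      using nz[of s1] Gamma3_bounds[of s1 s2 p] z by (simp add: zz poly3_eval_affine3)
    show "cmod (poly3_eval (affine3 0 0 (- 1) (3 * \<alpha>)) z) \<le> cmod (poly3_eval (affine3 3 (- \<alpha>) 0 0) z)"
      using Gamma3_ineq1[of s1 s2 p \<alpha>] z \<alpha> by (simp add: zz poly3_eval_affine3)
  qed
  then show "norm (3 *\<^sub>R cscale J \<alpha> (P x) - S2 x) \<le> norm (3 *\<^sub>R x - cscale J \<alpha> (S1 x))"
    by (simp add: poly3_op_affine3 three cscale_minus)
  have "norm (poly3_op J (affine3 0 (- 1) 0 (3 * \<alpha>)) S1 S2 P x)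
      \<le> norm (poly3_op J (affine3 3 0 (- \<alpha>) 0) S1 S2 P x)"
  proof (rule main[OF cb(2) coord(2) _ refl refl])
    show "poly3_op J (affine3 3 0 (- \<alpha>) 0) S1 S2 P x = 3 *\<^sub>R x - cscale J \<alpha> (S2 x)" for x
      by (simp add: poly3_op_affine3 three cscale_minus)
    fix z :: "complex \<times> complex \<times> complex" assume z: "z \<in> Gamma3"
    obtain s1 s2 p where zz: "z = (s1, s2, p)" by (metis prod_cases3)
    show "poly3_eval (affine3 3 0 (- \<alpha>) 0) z \<noteq> 0"
      using nz[of s2] Gamma3_bounds[of s1 s2 p] z by (simp add: zz poly3_eval_affine3)
    show "cmod (poly3_eval (affine3 0 (- 1) 0 (3 * \<alpha>)) z) \<le> cmod (poly3_eval (affine3 3 0 (- \<alpha>) 0) z)"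
      using Gamma3_ineq2[of s1 s2 p \<alpha>] z \<alpha> by (simp add: zz poly3_eval_affine3)
  qed
  then show "norm (3 *\<^sub>R cscale J \<alpha> (P x) - S1 x) \<le> norm (3 *\<^sub>R x - cscale J \<alpha> (S2 x))"
    by (simp add: poly3_op_affine3 three cscale_minus)
qed

text \<open>On the unit circle the denominator may fail to be invertible, but the inequality between
  vector norms is continuous in the scalar and is reached along \<open>r * \<beta>\<close> with
  \<open>r\<close> tending to 1 from below.\<close>

lemma pencil_circle_limit:
  fixes x y u v :: "'a::real_inner"
  assumes \<beta>: "cmod \<beta> = 1"
    and le: "\<And>\<alpha>. cmod \<alpha> < 1 \<Longrightarrow> norm (3 *\<^sub>R cscale J \<alpha> x - y) \<le> norm (3 *\<^sub>R u - cscale J \<alpha> v)"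
  shows "norm (3 *\<^sub>R cscale J \<beta> x - y) \<le> norm (3 *\<^sub>R u - cscale J \<beta> v)"
proof -
  have lim: "((\<lambda>r. cscale J (of_real r * \<beta>) z) \<longlongrightarrow> cscale J \<beta> z) (at_left 1)" for z
  proof -
    have "((\<lambda>r. (r * Re \<beta>) *\<^sub>R z + (r * Im \<beta>) *\<^sub>R J z) \<longlongrightarrow> (1 * Re \<beta>) *\<^sub>R z + (1 * Im \<beta>) *\<^sub>R J z) (at_left 1)"
      by (intro tendsto_intros)
    then show ?thesis by (simp add: cscale_def)
  qed
  have "eventually (\<lambda>r::real. 0 < r \<and> r < 1) (at_left 1)"
    using eventually_at_left_real[of 0 1] by simp
  then have ev: "eventually (\<lambda>r. norm (3 *\<^sub>R cscale J (of_real r * \<beta>) x - y)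
      \<le> norm (3 *\<^sub>R u - cscale J (of_real r * \<beta>) v)) (at_left 1)"
    by (rule eventually_mono) (intro le, simp add: norm_mult \<beta>)
  show ?thesis
    by (rule tendsto_le[OF _ _ _ ev]) (simp, (intro tendsto_norm tendsto_diff tendsto_scaleR tendsto_const lim)+)
qed

text \<open>After squaring, \<open>\<beta>\<close> survives only in the cross terms, which combine
  to 6 times the real part of \<open>\<beta> * cinner J (A x - adjoint B (P x)) x\<close>;
  \<open>\<beta>\<close> is chosen to make this real part the modulus.\<close>

lemma cmod_form_le_of_pencil:
  fixes A :: "'a::{real_inner, complete_space} \<Rightarrow> 'a"
  assumes J: "complex_structure J" and B: "cblinear J B"
    and pencil: "\<And>\<beta>. cmod \<beta> = 1 \<Longrightarrow> norm (3 *\<^sub>R cscale J \<beta> (P x) - B x) \<le> norm (3 *\<^sub>R x - cscale J \<beta> (A x))"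
  shows "6 * cmod (cinner J (A x - adjoint B (P x)) x)
    \<le> 9 * ((norm x)\<^sup>2 - (norm (P x))\<^sup>2) + (norm (A x))\<^sup>2 - (norm (B x))\<^sup>2"
proof -
  have bB: "bounded_linear B" and BJ: "\<And>x. B (J x) = J (B x)" using B by (auto simp: cblinear_def)
  have Re_c: "inner (cscale J c u) v = Re (c * cinner J u v)" for c u v
    unfolding cinner_cscale_left[OF J, symmetric] by (simp add: cinner_def)
  obtain \<beta> where \<beta>: "cmod \<beta> = 1"
    "Re (cinner J (A x - adjoint B (P x)) x * \<beta>) = cmod (cinner J (A x - adjoint B (P x)) x)"
    using ex_unimodular_rotation by blast
  have expand: "(norm (u - v))\<^sup>2 = (norm u)\<^sup>2 - 2 * inner u v + (norm v)\<^sup>2" for u v :: 'a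
    by (simp add: power2_norm_eq_inner inner_diff inner_commute)
  have adj: "cinner J (P x) (B x) = cinner J (adjoint B (P x)) x"
    by (simp add: cinner_def inner_adjoint_left[OF bB] BJ)
  have le: "(norm (3 *\<^sub>R cscale J \<beta> (P x) - B x))\<^sup>2 \<le> (norm (3 *\<^sub>R x - cscale J \<beta> (A x)))\<^sup>2"
    by (intro power_mono pencil \<beta>(1)) simp
  have eP: "(norm (3 *\<^sub>R cscale J \<beta> (P x) - B x))\<^sup>2
      = 9 * (norm (P x))\<^sup>2 - 6 * inner (cscale J \<beta> (adjoint B (P x))) x + (norm (B x))\<^sup>2"
    using norm_cscale[OF J, of \<beta> "P x"] \<beta>(1) Re_c[of \<beta> "P x" "B x"]
    by (simp add: expand adj Re_c)
  have eA: "(norm (3 *\<^sub>R x - cscale J \<beta> (A x)))\<^sup>2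
      = 9 * (norm x)\<^sup>2 - 6 * inner (cscale J \<beta> (A x)) x + (norm (A x))\<^sup>2"
    using norm_cscale[OF J, of \<beta> "A x"] \<beta>(1)
    by (simp add: expand inner_commute)
  have "cmod (cinner J (A x - adjoint B (P x)) x)
      = inner (cscale J \<beta> (A x)) x - inner (cscale J \<beta> (adjoint B (P x))) x"
    unfolding \<beta>(2)[symmetric] Re_c by (simp add: cinner_diff_left algebra_simps)
  then show ?thesis using le unfolding eP eA by (simp add: algebra_simps)
qed

section \<open>Factorization through the defect operator\<close>

text \<open>The bound is smallest at \<open>t^2 = b / a\<close>. Since \<open>a\<close> or
  \<open>b\<close> may vanish, both are first raised by \<open>e > 0\<close>, and \<open>e\<close>
  tends to 0 at the end.\<close>

lemma le_of_sum_squares_scaling: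
  fixes g C a b :: real
  assumes C: "0 \<le> C" and a: "0 \<le> a" and b: "0 \<le> b"
    and le: "\<And>t. 0 < t \<Longrightarrow> g \<le> C * ((t * a)\<^sup>2 + (b / t)\<^sup>2)"
  shows "g \<le> 2 * C * a * b"
proof -
  have e: "g \<le> 2 * C * (a + e) * (b + e)" if "0 < e" for e
  proof -
    define t where "t = sqrt ((b + e) / (a + e))"
    have pos: "0 < a + e" "0 < b + e" using a b that by auto
    then have t: "0 < t" "t\<^sup>2 = (b + e) / (a + e)" by (auto simp: t_def)
    have "(t * a)\<^sup>2 + (b / t)\<^sup>2 \<le> (t * (a + e))\<^sup>2 + ((b + e) / t)\<^sup>2"
      using a b that t(1) by (intro add_mono power_mono mult_left_mono divide_right_mono) auto
    also have "\<dots> = 2 * (a + e) * (b + e)"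
      unfolding power_mult_distrib power_divide t(2) using pos by (simp add: power2_eq_square)
    finally have "C * ((t * a)\<^sup>2 + (b / t)\<^sup>2) \<le> C * (2 * (a + e) * (b + e))"
      by (intro mult_left_mono C)
    then show ?thesis using le[OF t(1)] by (simp add: algebra_simps)
  qed
  have "((\<lambda>e. 2 * C * (a + e) * (b + e)) \<longlongrightarrow> 2 * C * (a + 0) * (b + 0)) (at_right 0)"
    by (intro tendsto_intros)
  moreover have "eventually (\<lambda>e. g \<le> 2 * C * (a + e) * (b + e)) (at_right 0)"
    using e by (auto simp: eventually_at_filter)
  ultimately show ?thesis
    using tendsto_lowerbound by fastforce
qed

text \<open>Polarization turns a bound on the quadratic form into one on the sesquilinear form.\<close>

lemma form_bounded_by_defect:
  fixes A D :: "'a::real_inner \<Rightarrow> 'a"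
  assumes J: "complex_structure J" and A: "cblinear J A" and D: "cblinear J D" and C: "0 \<le> C"
    and form: "\<And>x. cmod (cinner J (A x) x) \<le> C * (norm (D x))\<^sup>2"
  shows "\<bar>inner (A x) y\<bar> \<le> 2 * C * norm (D x) * norm (D y)"
proof -
  have Al: "linear A" and AJ: "\<And>x. A (J x) = J (A x)" and Dl: "linear D" and DJ: "\<And>x. D (J x) = J (D x)"
    using A D by (auto simp: cblinear_def bounded_linear.linear)
  have Jl: "linear J" and JJ: "\<And>x. J (J x) = - x" and Jin: "\<And>x y. inner (J x) (J y) = inner x y"
    using J by (auto simp: complex_structure_def)
  have re: "\<bar>inner (A x) x\<bar> \<le> C * (norm (D x))\<^sup>2" and im: "\<bar>inner (A x) (J x)\<bar> \<le> C * (norm (D x))\<^sup>2" for x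
    using form[of x] abs_Re_le_cmod[of "cinner J (A x) x"] abs_Im_le_cmod[of "cinner J (A x) x"]
    by (auto simp: cinner_def)
  have par: "(norm (D (x + y)))\<^sup>2 + (norm (D (x - y)))\<^sup>2 = 2 * (norm (D x))\<^sup>2 + 2 * (norm (D y))\<^sup>2" for x y
    by (simp add: linear_add[OF Dl] linear_diff[OF Dl] power2_norm_eq_inner inner_add inner_diff inner_commute)
  \<comment> \<open>The first difference gives twice \<open>inner (A x) y + inner (A y) x\<close>,
    the one with \<open>J\<close> twice \<open>inner (A x) y - inner (A y) x\<close>; so
    \<open>inner (A y) x\<close> cancels although \<open>A\<close> need not be symmetric.\<close>
  have pol: "4 * inner (A x) y = inner (A (x + y)) (x + y) - inner (A (x - y)) (x - y)
      + inner (A (x - J y)) (J (x - J y)) - inner (A (x + J y)) (J (x + J y))" for x y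
    by (simp add: linear_add[OF Al] linear_diff[OF Al] linear_add[OF Jl] linear_diff[OF Jl] AJ JJ
        inner_add_left inner_add_right inner_diff_left inner_diff_right Jin complex_structure_inner[OF J])
  have sq: "\<bar>inner (A x) y\<bar> \<le> C * ((norm (D x))\<^sup>2 + (norm (D y))\<^sup>2)" for x y
  proof -
    have "4 * \<bar>inner (A x) y\<bar> \<le> C * (norm (D (x + y)))\<^sup>2 + C * (norm (D (x - y)))\<^sup>2
        + C * (norm (D (x - J y)))\<^sup>2 + C * (norm (D (x + J y)))\<^sup>2"
      using pol[of x y] re[of "x + y"] re[of "x - y"] im[of "x + J y"] im[of "x - J y"] by linarith
    also have "\<dots> = C * ((norm (D (x + y)))\<^sup>2 + (norm (D (x - y)))\<^sup>2)
        + C * ((norm (D (x + J y)))\<^sup>2 + (norm (D (x - J y)))\<^sup>2)"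
      by (simp add: algebra_simps)
    also have "\<dots> = 4 * (C * ((norm (D x))\<^sup>2 + (norm (D y))\<^sup>2))"
      unfolding par DJ complex_structure_norm[OF J] by (simp add: algebra_simps)
    finally show ?thesis by simp
  qed
  have "\<bar>inner (A x) y\<bar> \<le> 2 * C * norm (D x) * norm (D y)"
  proof (rule le_of_sum_squares_scaling[OF C])
    fix t :: real assume t: "0 < t"
    \<comment> \<open>Scaling \<open>x\<close> by \<open>t\<close> and \<open>y\<close> by
      \<open>1 / t\<close> preserves the form but rebalances the two squares.\<close>
    have "inner (A x) y = inner (A (t *\<^sub>R x)) ((1 / t) *\<^sub>R y)"
      using t by (simp add: linear_cmul[OF Al])
    then have "\<bar>inner (A x) y\<bar> \<le> C * ((norm (D (t *\<^sub>R x)))\<^sup>2 + (norm (D ((1 / t) *\<^sub>R y)))\<^sup>2)"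
      using sq[of "t *\<^sub>R x" "(1 / t) *\<^sub>R y"] by simp
    then show "\<bar>inner (A x) y\<bar> \<le> C * ((t * norm (D x))\<^sup>2 + (norm (D y) / t)\<^sup>2)"
      using t by (simp add: linear_cmul[OF Dl] divide_inverse mult.commute)
  qed auto
  then show ?thesis .
qed

section \<open>Factorization through a symmetric operator, and its uniqueness\<close>

lemma subspace_closure:
  fixes S :: "'a::real_normed_vector set"
  assumes S: "subspace S"
  shows "subspace (closure S)"
proof (rule subspaceI)
  show "0 \<in> closure S" using subspace_0[OF S] closure_subset by blast
next
  fix x y assume "x \<in> closure S" "y \<in> closure S"
  then obtain f g where "\<And>n. f n \<in> S" "f \<longlonglongrightarrow> x" "\<And>n. g n \<in> S" "g \<longlonglongrightarrow> y"
    unfolding closure_sequential by auto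
  then have "\<And>n. f n + g n \<in> S" "(\<lambda>n. f n + g n) \<longlonglongrightarrow> x + y"
    using subspace_add[OF S] tendsto_add by blast+
  then show "x + y \<in> closure S" unfolding closure_sequential by metis
next
  fix c :: real and x assume "x \<in> closure S"
  then obtain f where "\<And>n. f n \<in> S" "f \<longlonglongrightarrow> x"
    unfolding closure_sequential by auto
  then have "\<And>n. c *\<^sub>R f n \<in> S" "(\<lambda>n. c *\<^sub>R f n) \<longlonglongrightarrow> c *\<^sub>R x"
    using subspace_scale[OF S] tendsto_scaleR[OF tendsto_const] by blast+
  then show "c *\<^sub>R x \<in> closure S" unfolding closure_sequential by metis
qed

text \<open>Riesz representation is used twice. First it gives \<open>u x\<close>, the prospective
  value of \<open>F\<close> at \<open>D x\<close>. Instead of extending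
  \<open>D x \<mapsto> u x\<close> by density, the second use constructs the adjoint
  \<open>G\<close> of that map on the whole space, and \<open>F\<close> is
  \<open>adjoint G\<close>.\<close>

lemma factor_through_defect:
  fixes A D :: "'a::{real_inner, complete_space} \<Rightarrow> 'a"
  assumes J: "complex_structure J" and A: "cblinear J A" and D: "cblinear J D"
    and sym: "\<And>x y. inner (D x) y = inner x (D y)"
    and K: "\<And>x y. \<bar>inner (A x) y\<bar> \<le> K * norm (D x) * norm (D y)"
  shows "\<exists>F. op_on J (closure (range D)) F \<and> (\<forall>x. A x = D (F (D x)))"
proof -
  have Ab: "bounded_linear A" and AJ: "\<And>x. A (J x) = J (A x)"
    and Db: "bounded_linear D" and DJ: "\<And>x. D (J x) = J (D x)"
    using A D by (auto simp: cblinear_def)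
  note Al = bounded_linear.linear[OF Ab] and Dl = bounded_linear.linear[OF Db]
  have JJ: "\<And>x. J (J x) = - x" and Jin: "\<And>x y. inner (J x) (J y) = inner x y"
    using J by (auto simp: complex_structure_def)
  note Jb = complex_structure_bounded_linear[OF J]
  define V where "V = closure (range D)"
  have sub: "subspace V"
    unfolding V_def by (rule subspace_closure[OF linear_subspace_image[OF Dl subspace_UNIV]])
  have VJ: "J v \<in> V" if "v \<in> V" for v
  proof -
    have "J ` closure (range D) \<subseteq> closure (J ` range D)"
      by (rule image_closure_subset) (auto intro: linear_continuous_on[OF Jb] closure_subset[THEN subsetD])
    also have "\<dots> \<subseteq> V" unfolding V_def by (rule closure_mono) (auto simp: DJ[symmetric])
    finally show ?thesis using that by (auto simp: V_def)
  qed
  have Veq: "u = v" if "u \<in> V" "v \<in> V" "\<And>y. inner u (D y) = inner v (D y)" for u v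
    using closure_range_eqI that unfolding V_def by blast
  have "\<exists>u\<in>V. \<forall>y. inner (A x) y = inner u (D y)" for x
    unfolding V_def
    by (rule riesz_closure_range[OF Dl bounded_linear.linear[OF bounded_linear_inner_right] K])
  then obtain u where uV: "\<And>x. u x \<in> V" and u: "\<And>x y. inner (A x) y = inner (u x) (D y)" by metis
  have u_add: "u (x + z) = u x + u z" for x z
    by (rule Veq) (auto simp: uV subspace_add[OF sub] inner_add_left u[symmetric] linear_add[OF Al])
  have u_scale: "u (r *\<^sub>R x) = r *\<^sub>R u x" for r x
    by (rule Veq) (auto simp: uV subspace_scale[OF sub] u[symmetric] linear_cmul[OF Al])
  have uJ: "u (J x) = J (u x)" for x
    by (rule Veq) (auto simp: uV VJ complex_structure_inner[OF J] u[symmetric] AJ DJ[symmetric])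
  \<comment> \<open>The bound is tested on the range, extended to \<open>V\<close> and applied to
    \<open>u x\<close> itself. In particular \<open>u x\<close> depends on \<open>D x\<close>
    only.\<close>
  have u_bound: "norm (u x) \<le> K * norm (D x)" for x
  proof -
    have "closed {w. inner (u x) w \<le> K * norm (D x) * norm w}"
      by (intro closed_Collect_le continuous_intros)
    moreover have "inner (u x) (D y) \<le> K * norm (D x) * norm (D y)" for y
      using K[of x y] by (simp add: u)
    ultimately have "V \<subseteq> {w. inner (u x) w \<le> K * norm (D x) * norm w}"
      unfolding V_def by (intro closure_minimal) auto
    then have "norm (u x) * norm (u x) \<le> K * norm (D x) * norm (u x)"
      using uV[of x] by (auto simp: norm_eq_sqrt_inner[symmetric] power2_norm_eq_inner[symmetric] power2_eq_square)
    moreover have "0 \<le> K * norm (D x)"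
    proof (cases "D x = 0")
      case False
      have "0 \<le> K * norm (D x) * norm (D x)" using K[of x x] by linarith
      then show ?thesis using False by (simp add: zero_le_mult_iff)
    qed simp
    ultimately show ?thesis by (cases "u x = 0") auto
  qed
  have "\<exists>v\<in>V. \<forall>x. inner (u x) w = inner v (D x)" for w
    unfolding V_def
  proof (rule riesz_closure_range[OF Dl])
    show "linear (\<lambda>x. inner (u x) w)"
      by (rule linearI) (simp_all add: u_add u_scale inner_add_left)
    show "\<bar>inner (u x) w\<bar> \<le> (K * norm w) * norm (D x)" for x
      using Cauchy_Schwarz_ineq2[of "u x" w] mult_right_mono[OF u_bound[of x] norm_ge_zero[of w]]
      by (simp add: ac_simps)
  qed
  then obtain G where GV: "\<And>w. G w \<in> V" and G: "\<And>w x. inner (u x) w = inner (G w) (D x)" by metis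
  have "bounded_linear G"
  proof (rule bounded_linear_intro[where K = "\<bar>K\<bar>"])
    show "G (x + z) = G x + G z" for x z
      by (rule Veq) (auto simp: GV subspace_add[OF sub] inner_add_left inner_add_right G[symmetric])
    show "G (r *\<^sub>R x) = r *\<^sub>R G x" for r x
      by (rule Veq) (auto simp: GV subspace_scale[OF sub] G[symmetric])
    fix w
    have "closed {v. inner (G w) v \<le> norm w * \<bar>K\<bar> * norm v}"
      by (intro closed_Collect_le continuous_intros)
    moreover have "inner (G w) (D x) \<le> norm w * \<bar>K\<bar> * norm (D x)" for x
    proof -
      have "inner (G w) (D x) \<le> norm (u x) * norm w" unfolding G[symmetric] by (rule norm_cauchy_schwarz)
      also have "\<dots> \<le> (\<bar>K\<bar> * norm (D x)) * norm w"
        using u_bound[of x] mult_right_mono[OF abs_ge_self[of K] norm_ge_zero[of "D x"]]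
        by (intro mult_right_mono) auto
      finally show ?thesis by (simp add: ac_simps)
    qed
    ultimately have "V \<subseteq> {v. inner (G w) v \<le> norm w * \<bar>K\<bar> * norm v}"
      unfolding V_def by (intro closure_minimal) auto
    then have "norm (G w) * norm (G w) \<le> norm w * \<bar>K\<bar> * norm (G w)"
      using GV[of w] by (auto simp: power2_norm_eq_inner[symmetric] power2_eq_square)
    then show "norm (G w) \<le> norm w * \<bar>K\<bar>" by (cases "G w = 0") auto
  qed
  moreover have "G (J w) = J (G w)" for w
  proof (rule Veq)
    fix x
    have "inner (G (J w)) (D x) = - inner (u (J x)) w"
      by (simp add: G[symmetric] uJ complex_structure_inner[OF J])
    also have "\<dots> = inner (J (G w)) (D x)" by (simp add: G DJ complex_structure_inner[OF J])
    finally show "inner (G (J w)) (D x) = inner (J (G w)) (D x)" .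
  qed (auto simp: GV VJ)
  ultimately have Gc: "cblinear J G" and Gb: "bounded_linear G" by (auto simp: cblinear_def)
  define F where "F = adjoint G"
  have Fc: "cblinear J F" unfolding F_def by (rule cblinear_adjoint[OF J Gc])
  have FD: "F (D x) = u x" for x
    by (rule vector_eq_rdot[THEN iffD1]) (simp add: F_def inner_adjoint_left[OF Gb] G inner_commute[of "D x"])
  have "F ` V \<subseteq> V"
  proof -
    have "F ` closure (range D) \<subseteq> closure (F ` range D)"
      using Fc by (intro image_closure_subset) (auto simp: cblinear_def intro: linear_continuous_on closure_subset[THEN subsetD])
    also have "\<dots> \<subseteq> V" by (rule closure_minimal) (auto simp: FD uV, simp add: V_def)
    finally show ?thesis by (simp add: V_def)
  qed
  moreover have "A x = D (F (D x))" for x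
    by (rule vector_eq_rdot[THEN iffD1]) (simp add: FD u sym)
  ultimately show ?thesis using Fc unfolding op_on_def V_def by blast
qed

text \<open>By symmetry of \<open>D\<close>, the products \<open>D F D\<close> fix every
  \<open>inner (F (D y)) (D w)\<close>, which determine \<open>F (D y)\<close> within the closure of
  the range; continuity does the rest.\<close>

lemma factor_through_defect_unique:
  fixes D F G :: "'a::real_inner \<Rightarrow> 'a"
  assumes sym: "\<And>x y. inner (D x) y = inner x (D y)"
    and F: "op_on J (closure (range D)) F" and G: "op_on J (closure (range D)) G"
    and eq: "\<And>x. D (F (D x)) = D (G (D x))" and x: "x \<in> closure (range D)"
  shows "F x = G x"
proof -
  have Fb: "bounded_linear F" and Gb: "bounded_linear G" using F G by (auto simp: op_on_def cblinear_def)
  have "F (D y) = G (D y)" for y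
  proof (rule closure_range_eqI)
    show "F (D y) \<in> closure (range D)" "G (D y) \<in> closure (range D)"
      using F G closure_subset[of "range D"] by (auto simp: op_on_def)
    show "inner (F (D y)) (D w) = inner (G (D y)) (D w)" for w
      by (simp add: sym[symmetric] eq)
  qed
  moreover have "closed {x. F x = G x}"
    by (intro closed_Collect_eq linear_continuous_on Fb Gb)
  ultimately have "closure (range D) \<subseteq> {x. F x = G x}" by (intro closure_minimal) auto
  then show ?thesis using x by blast
qed

text \<open>The hypothesis is homogeneous, so that it can be verified on unnormalized vectors and
  passed to a closure. The 0 inserted in the supremum accounts for \<open>0 \<le> c\<close>.\<close>

lemma numerical_radius_le:
  assumes "\<And>x. x \<in> V \<Longrightarrow> cmod (cinner J (A x) x) \<le> c * (norm x)\<^sup>2" and "0 \<le> c"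
  shows "numerical_radius J V A \<le> c"
  unfolding numerical_radius_def
proof (rule cSup_least)
  fix r assume "r \<in> insert 0 {cmod (cinner J (A x) x) | x. x \<in> V \<and> norm x = 1}"
  then show "r \<le> c" using assms(1) assms(2) by force
qed simp

section \<open>Existence, uniqueness and numerical radius of the two operators\<close>

theorem theorem4p8:
  fixes J S1 S2 P :: "'a::{real_inner, complete_space} \<Rightarrow> 'a"
  assumes "complex_structure J"
    and "gamma3_contraction J S1 S2 P"
  shows "\<exists>F1 F2.
     op_on J (defect_space J P) F1 \<and> op_on J (defect_space J P) F2
   \<and> (\<forall>x. S1 x - adjoint S2 (P x) = defect_op J P (F1 (defect_op J P x)))
   \<and> (\<forall>x. S2 x - adjoint S1 (P x) = defect_op J P (F2 (defect_op J P x)))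
   \<and> (\<forall>G1 G2. op_on J (defect_space J P) G1 \<and> op_on J (defect_space J P) G2
        \<and> (\<forall>x. S1 x - adjoint S2 (P x) = defect_op J P (G1 (defect_op J P x)))
        \<and> (\<forall>x. S2 x - adjoint S1 (P x) = defect_op J P (G2 (defect_op J P x)))
        \<longrightarrow> (\<forall>x\<in>defect_space J P. G1 x = F1 x \<and> G2 x = F2 x))
   \<and> (\<forall>z. cmod z = 1 \<longrightarrow>
        numerical_radius J (defect_space J P) (\<lambda>x. F1 x + cscale J z (F2 x)) \<le> 3)"
proof -
  note J = assms(1) and G = assms(2)
  have cb: "cblinear J S1" "cblinear J S2" "cblinear J P"
    using G by (auto simp: gamma3_contraction_def)
  have contr: "norm (P x) \<le> norm x" for x by (rule gamma3_contraction_coord_norm_le(3)[OF J G])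
  define D where "D = defect_op J P"
  note defect = defect_op_contraction[OF J cb(3) contr, folded D_def]
  have V: "defect_space J P = closure (range D)" by (simp add: defect_space_def D_def)
  have bP: "bounded_linear P" using cb(3) by (simp add: cblinear_def)
  have normD: "(norm (D x))\<^sup>2 = (norm x)\<^sup>2 - (norm (P x))\<^sup>2" for x
  proof -
    have "(norm (D x))\<^sup>2 = inner x (x - adjoint P (P x))"
      by (simp add: power2_norm_eq_inner defect(2) defect(3))
    also have "\<dots> = (norm x)\<^sup>2 - (norm (P x))\<^sup>2"
      by (simp add: inner_diff_right inner_adjoint_right[OF bP] power2_norm_eq_inner)
    finally show ?thesis .
  qed
  define A where "A x = S1 x - adjoint S2 (P x)" for x
  define B where "B x = S2 x - adjoint S1 (P x)" for x
  have cA: "cblinear J A" and cB: "cblinear J B"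
    unfolding A_def[abs_def] B_def[abs_def]
    by (intro cblinear_diff cblinear_compose[OF cblinear_adjoint[OF J]] cb J)+
  have "6 * cmod (cinner J (A x) x) \<le> 9 * (norm (D x))\<^sup>2 + (norm (S1 x))\<^sup>2 - (norm (S2 x))\<^sup>2" for x
    unfolding A_def normD
  proof (rule cmod_form_le_of_pencil[OF J cb(2)])
    show "norm (3 *\<^sub>R cscale J \<beta> (P x) - S2 x) \<le> norm (3 *\<^sub>R x - cscale J \<beta> (S1 x))" if "cmod \<beta> = 1" for \<beta>
      using that pencil_open_disc(1)[OF J G] by (rule pencil_circle_limit)
  qed
  moreover have "6 * cmod (cinner J (B x) x) \<le> 9 * (norm (D x))\<^sup>2 + (norm (S2 x))\<^sup>2 - (norm (S1 x))\<^sup>2" for x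
    unfolding B_def normD
  proof (rule cmod_form_le_of_pencil[OF J cb(1)])
    show "norm (3 *\<^sub>R cscale J \<beta> (P x) - S1 x) \<le> norm (3 *\<^sub>R x - cscale J \<beta> (S2 x))" if "cmod \<beta> = 1" for \<beta>
      using that pencil_open_disc(2)[OF J G] by (rule pencil_circle_limit)
  qed
  ultimately have sum: "6 * cmod (cinner J (A x) x) + 6 * cmod (cinner J (B x) x)
      \<le> (9 * (norm (D x))\<^sup>2 + (norm (S1 x))\<^sup>2 - (norm (S2 x))\<^sup>2)
        + (9 * (norm (D x))\<^sup>2 + (norm (S2 x))\<^sup>2 - (norm (S1 x))\<^sup>2)" for x
    by (rule add_mono)
  have form: "cmod (cinner J (A x) x) + cmod (cinner J (B x) x) \<le> 3 * (norm (D x))\<^sup>2" for x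
    using sum[of x] by simp
  \<comment> \<open>The separate bounds suffice for the factorizations; the joint bound
    \<open>form\<close> is kept for the numerical radius.\<close>
  have formA: "cmod (cinner J (A x) x) \<le> 3 * (norm (D x))\<^sup>2"
    and formB: "cmod (cinner J (B x) x) \<le> 3 * (norm (D x))\<^sup>2" for x
    using form[of x] norm_ge_zero[of "cinner J (A x) x"] norm_ge_zero[of "cinner J (B x) x"] by linarith+
  obtain F1 where F1: "op_on J (closure (range D)) F1" "\<And>x. A x = D (F1 (D x))"
    using factor_through_defect[OF J cA defect(1,2) form_bounded_by_defect[OF J cA defect(1) _ formA]] by auto
  obtain F2 where F2: "op_on J (closure (range D)) F2" "\<And>x. B x = D (F2 (D x))"
    using factor_through_defect[OF J cB defect(1,2) form_bounded_by_defect[OF J cB defect(1) _ formB]] by auto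
  have DJ: "D (J x) = J (D x)" for x using defect(1) by (simp add: cblinear_def)
  have radius: "numerical_radius J (closure (range D)) (\<lambda>x. F1 x + cscale J z (F2 x)) \<le> 3"
    if z: "cmod z = 1" for z
  proof (rule numerical_radius_le)
    let ?F = "\<lambda>x. F1 x + cscale J z (F2 x)"
    have range: "cmod (cinner J (?F (D y)) (D y)) \<le> 3 * (norm (D y))\<^sup>2" for y
    proof -
      \<comment> \<open>\<open>D\<close> commutes with \<open>J\<close>, so it is symmetric for the
        complex inner product too; the forms of \<open>F1\<close> and \<open>F2\<close> at
        \<open>D y\<close> become those of \<open>A\<close> and \<open>B\<close> at
        \<open>y\<close>.\<close>
      have move: "cinner J (F (D y)) (D y) = cinner J (D (F (D y))) y" for F
        by (simp add: cinner_def defect(2) DJ)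
      have "cmod (cinner J (?F (D y)) (D y)) = cmod (cinner J (A y) y + z * cinner J (B y) y)"
        by (simp add: cinner_add_left cinner_cscale_left[OF J] move F1(2) F2(2))
      also have "\<dots> \<le> cmod (cinner J (A y) y) + cmod (cinner J (B y) y)"
        using norm_triangle_ineq[of "cinner J (A y) y" "z * cinner J (B y) y"] z by (simp add: norm_mult)
      also have "\<dots> \<le> 3 * (norm (D y))\<^sup>2" by (rule form)
      finally show ?thesis .
    qed
    have "cblinear J ?F"
      using F1(1) F2(1) by (intro cblinear_add cblinear_cscale_compose J) (auto simp: op_on_def)
    then have cont: "continuous_on UNIV ?F" by (auto simp: cblinear_def intro: linear_continuous_on)
    \<comment> \<open>A closed condition, so it passes from the range of \<open>D\<close> to the
      whole defect space.\<close>
    have "closed {x. cmod (cinner J (?F x) x) \<le> 3 * (norm x)\<^sup>2}"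
      unfolding cinner_def Complex_eq
      by (intro closed_Collect_le continuous_intros cont
          linear_continuous_on[OF complex_structure_bounded_linear[OF J]])
    then have "closure (range D) \<subseteq> {x. cmod (cinner J (?F x) x) \<le> 3 * (norm x)\<^sup>2}"
      using range by (intro closure_minimal) auto
    then show "cmod (cinner J (?F x) x) \<le> 3 * (norm x)\<^sup>2" if "x \<in> closure (range D)" for x
      using that by blast
  qed simp
  have unique: "G x = F x"
    if "op_on J (closure (range D)) G" "op_on J (closure (range D)) F"
      "\<And>x. T x = D (G (D x))" "\<And>x. T x = D (F (D x))" "x \<in> closure (range D)" for F G T x
    using factor_through_defect_unique[OF defect(2) that(1,2)] that(3-5) by metis
  show ?thesis
    unfolding V D_def[symmetric] A_def[symmetric] B_def[symmetric]
    using F1 F2 radius unique[of _ F1 A] unique[of _ F2 B]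
    by (intro exI[of _ F1] exI[of _ F2]) blast
qed

end
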